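(* Fix $\boldsymbol\omega=(P,Q,W)\in\Omega$ and $K\subset\{1,\dots,2d\}$. Let $\mathbf A\in\mathcal O_K^{\mathbb C}$, let $\lambda_*$ be a simple eigenvalue of $(\boldsymbol\omega,\mathbf A)$, let $y$ be an eigenfunction for $\lambda_*$ normalized by $\int_a^b y^*Wy\,dt=1$, and let $\Lambda$ be a continuous simple eigenvalue branch defined on a neighborhood of $\mathbf A$ in $\mathcal O_K^{\mathbb C}$ through $\lambda_*$. Then $\Lambda$, regarded as a function of the Hermitian matrix $S(\mathbf B)$, is (Fréchet) differentiable at $\mathbf A$, and for every $2d\times2d$ Hermitian matrix $H$, $$d\Lambda\big|_{\mathbf A}(H)=u^*Hu,$$ where $u=(u_1,\dots,u_{2d})^T$ with $u_i=\rho_i$ for $i\in\{1,\dots,2d\}\setminus K$ and $u_i=\eta_i$ for $i\in K$, and $(\rho_1,\dots,\rho_{2d},\eta_1,\dots,\eta_{2d}):=(-y(a)^T,y(b)^T,(Py')(a)^T,(Py')(b)^T)$.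
   Context: Let $d\ge2$, $[a,b]$ compact. $\Omega$ is the set of triples $(P,Q,W)$ of $d\times d$ real symmetric matrix-valued functions in $L^\infty([a,b],\mathbb R^{d\times d})$ with $P(t)\ge\mu_1I_d$, $W(t)\ge\mu_2I_d$ a.e. for some $\mu_1,\mu_2>0$. $\mathcal B^{\mathbb C}$ is the quotient of the set of complex $2d\times4d$ matrices $(A\,|\,B)$ with $\operatorname{rank}(A\,|\,B)=2d$, $AB^*=BA^*$ by the left action of $GL(2d,\mathbb C)$, with quotient topology. The problem $(\boldsymbol\omega,[A\,|\,B])$ is $-(Py')'+Qy=\lambda Wy$ on $[a,b]$ with $(A\,|\,B)(-y(a)^T,y(b)^T,(Py')(a)^T,(Py')(b)^T)^T=0$; its eigenvalues are real and isolated, and an eigenvalue is simple if its multiplicity (equivalently, the dimension of its eigenspace) is $1$. For $K\subset\{1,\dots,2d\}$, $\mathcal O_K^{\mathbb C}$ is the set of $[A\,|\,B]$ having a representative with columns $a_i=-e_i$, $b_i=s_i$ ($i\in K$), $a_i=s_i$, $b_i=e_i$ ($i\notin K$), for a Hermitian $2d\times 2d$ matrix $S=(s_1,\dots,s_{2d})$ (uniquely determined, denoted $S(\mathbf A)$); $\mathbf B\mapsto S(\mathbf B)$ identifies $\mathcal O_K^{\mathbb C}$ with the real vector space of Hermitian $2d\times2d$ matrices. A continuous simple eigenvalue branch through $\lambda_*$ on a neighborhood $U$ of $\mathbf A$ is a continuous function $\Lambda:U\to\mathbb R$ with $\Lambda(\mathbf A)=\lambda_*$ such that, for some $r_1<\lambda_*<r_2$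 with $\lambda_*$ the only eigenvalue of $(\boldsymbol\omega,\mathbf A)$ in $[r_1,r_2]$, for each $\mathbf B\in U$ the number $\Lambda(\mathbf B)$ is the unique eigenvalue of $(\boldsymbol\omega,\mathbf B)$ in $(r_1,r_2)$ and is simple. *)

theory Defs
  imports "HOL-Analysis.Analysis"
begin

text \<open>Dimension d is CARD('n); indices 1..2d are the elements of 'n + 'n, where
  Inl i stands for the entry i of the "a"-block and Inr i for the "b"-block.\<close>

definition Linf_on :: "real \<Rightarrow> real \<Rightarrow> (real \<Rightarrow> real) \<Rightarrow> bool" where
  "Linf_on a b f \<longleftrightarrow> f \<in> borel_measurable (lebesgue_on {a..b}) \<and>
     (\<exists>C. AE t in lebesgue_on {a..b}. \<bar>f t\<bar> \<le> C)"

definition sym_Linf :: "real \<Rightarrow> real \<Rightarrow> (real \<Rightarrow> real^'n^'n) \<Rightarrow> bool" where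
  "sym_Linf a b M \<longleftrightarrow> (\<forall>i j. Linf_on a b (\<lambda>t. M t $ i $ j)) \<and>
     (AE t in lebesgue_on {a..b}. transpose (M t) = M t)"

definition unif_pos :: "real \<Rightarrow> real \<Rightarrow> (real \<Rightarrow> real^'n^'n) \<Rightarrow> bool" where
  "unif_pos a b M \<longleftrightarrow> (\<exists>\<mu>>0. AE t in lebesgue_on {a..b}.
      \<forall>x::real^'n. \<mu> * (x \<bullet> x) \<le> x \<bullet> (M t *v x))"

definition in_Omega :: "real \<Rightarrow> real \<Rightarrow> (real \<Rightarrow> real^'n^'n) \<Rightarrow> (real \<Rightarrow> real^'n^'n)
    \<Rightarrow> (real \<Rightarrow> real^'n^'n) \<Rightarrow> bool" where
  "in_Omega a b P Q W \<longleftrightarrow> sym_Linf a b P \<and> sym_Linf a b Q \<and> sym_Linf a b W \<and>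
     unif_pos a b P \<and> unif_pos a b W"

text \<open>Absolute continuity on [a,b] (Lebesgue characterisation: indefinite integral of an
  integrable function).\<close>
definition abs_cont_on :: "real \<Rightarrow> real \<Rightarrow> (real \<Rightarrow> 'a::euclidean_space) \<Rightarrow> bool" where
  "abs_cont_on a b f \<longleftrightarrow> (\<exists>g. g absolutely_integrable_on {a..b} \<and>
     (\<forall>t\<in>{a..b}. f t = f a + integral {a..t} g))"

definition cmat :: "real^'n^'m \<Rightarrow> complex^'n^'m" where
  "cmat M = (\<chi> i j. complex_of_real (M $ i $ j))"

text \<open>y solves -(P y')' + Q y = lam W y on [a,b] with quasi-derivative z = P y'
  (y and P y' absolutely continuous, equations almost everywhere).\<close>
definition sl_solution :: "real \<Rightarrow> real \<Rightarrow> (real \<Rightarrow> real^'n^'n) \<Rightarrow> (real \<Rightarrow> real^'n^'n)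
    \<Rightarrow> (real \<Rightarrow> real^'n^'n) \<Rightarrow> real \<Rightarrow> (real \<Rightarrow> complex^'n) \<Rightarrow> (real \<Rightarrow> complex^'n) \<Rightarrow> bool" where
  "sl_solution a b P Q W lam y z \<longleftrightarrow> abs_cont_on a b y \<and> abs_cont_on a b z \<and>
     (AE t in lebesgue_on {a..b}. \<exists>v. (y has_vector_derivative v) (at t) \<and> z t = cmat (P t) *v v) \<and>
     (AE t in lebesgue_on {a..b}.
        (z has_vector_derivative (cmat (Q t) *v y t - complex_of_real lam *s (cmat (W t) *v y t))) (at t))"

definition bd_rho :: "real \<Rightarrow> real \<Rightarrow> (real \<Rightarrow> complex^'n) \<Rightarrow> ('n + 'n) \<Rightarrow> complex" where
  "bd_rho a b y k = (case k of Inl i \<Rightarrow> - (y a $ i) | Inr i \<Rightarrow> y b $ i)"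

definition bd_eta :: "real \<Rightarrow> real \<Rightarrow> (real \<Rightarrow> complex^'n) \<Rightarrow> ('n + 'n) \<Rightarrow> complex" where
  "bd_eta a b z k = (case k of Inl i \<Rightarrow> z a $ i | Inr i \<Rightarrow> z b $ i)"

definition hermitian :: "complex^'m^'m \<Rightarrow> bool" where
  "hermitian S \<longleftrightarrow> (\<forall>i j. S $ i $ j = cnj (S $ j $ i))"

text \<open>The canonical representative (A|B) of the element of O_K with S(A) = S:
  columns a_i = -e_i, b_i = s_i (i in K), a_i = s_i, b_i = e_i (i not in K).\<close>
definition bcA :: "('m::finite) set \<Rightarrow> complex^'m^'m \<Rightarrow> complex^'m^'m" where
  "bcA K S = (\<chi> i j. if j \<in> K then (if i = j then -1 else 0) else S $ i $ j)"

definition bcB :: "('m::finite) set \<Rightarrow> complex^'m^'m \<Rightarrow> complex^'m^'m" where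
  "bcB K S = (\<chi> i j. if j \<in> K then S $ i $ j else (if i = j then 1 else 0))"

definition satisfies_bc :: "real \<Rightarrow> real \<Rightarrow> ('n::finite + 'n) set \<Rightarrow> complex^('n+'n)^('n+'n)
    \<Rightarrow> (real \<Rightarrow> complex^'n) \<Rightarrow> (real \<Rightarrow> complex^'n) \<Rightarrow> bool" where
  "satisfies_bc a b K S y z \<longleftrightarrow>
     bcA K S *v (\<chi> k. bd_rho a b y k) + bcB K S *v (\<chi> k. bd_eta a b z k) = 0"

text \<open>Eigenspace of (omega, [A|B]) with [A|B] in O_K, S = S([A|B]), for the real number lam
  (functions are taken to vanish outside [a,b]).\<close>
definition eigenspace_SL :: "real \<Rightarrow> real \<Rightarrow> (real \<Rightarrow> real^'n^'n) \<Rightarrow> (real \<Rightarrow> real^'n^'n)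
    \<Rightarrow> (real \<Rightarrow> real^'n^'n) \<Rightarrow> ('n::finite + 'n) set \<Rightarrow> complex^('n+'n)^('n+'n) \<Rightarrow> real
    \<Rightarrow> (real \<Rightarrow> complex^'n) set" where
  "eigenspace_SL a b P Q W K S lam = {y. (\<forall>t. t \<notin> {a..b} \<longrightarrow> y t = 0) \<and>
     (\<exists>z. sl_solution a b P Q W lam y z \<and> satisfies_bc a b K S y z)}"

definition is_eigenvalue_SL where
  "is_eigenvalue_SL a b P Q W K S lam \<longleftrightarrow>
     (\<exists>y\<in>eigenspace_SL a b P Q W K S lam. \<exists>t\<in>{a..b}. y t \<noteq> 0)"

definition simple_eigenvalue_SL where
  "simple_eigenvalue_SL a b P Q W K S lam \<longleftrightarrow>
     (\<exists>y0\<in>eigenspace_SL a b P Q W K S lam. (\<exists>t\<in>{a..b}. y0 t \<noteq> 0) \<and>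
        (\<forall>y\<in>eigenspace_SL a b P Q W K S lam. \<exists>c::complex. \<forall>t. y t = c *s y0 t))"

definition herm_set :: "(complex^'m^'m) set" where
  "herm_set = {S. hermitian S}"

text \<open>Continuous simple eigenvalue branch through lam0 on U (a neighbourhood of S0 in O_K,
  identified via S with the Hermitian matrices).\<close>
definition simple_branch where
  "simple_branch a b P Q W K S0 lam0 U (Lam :: complex^('n::finite+'n)^('n+'n) \<Rightarrow> real) \<longleftrightarrow>
     S0 \<in> U \<and> U \<subseteq> herm_set \<and> continuous_on U Lam \<and> Lam S0 = lam0 \<and>
     (\<exists>r1 r2. r1 < lam0 \<and> lam0 < r2 \<and>
        (\<forall>mu\<in>{r1..r2}. is_eigenvalue_SL a b P Q W K S0 mu \<longrightarrow> mu = lam0) \<and>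
        (\<forall>S\<in>U. r1 < Lam S \<and> Lam S < r2 \<and> is_eigenvalue_SL a b P Q W K S (Lam S) \<and>
           simple_eigenvalue_SL a b P Q W K S (Lam S) \<and>
           (\<forall>mu\<in>{r1<..<r2}. is_eigenvalue_SL a b P Q W K S mu \<longrightarrow> mu = Lam S)))"

end

theory Submission
  imports Defs
begin

text \<open>
  Let \<open>y'\<close> be an eigenfunction for \<open>S'\<close> and \<open>lam'\<close>. Integrating Lagrange's identity for \<open>y\<close> and
  \<open>y'\<close> gives \<open>(lam' - lam0) * \<integral> y^* W y' = u^* (S' - S0) u'\<close>, where \<open>u, u'\<close> are the boundary
  vectors. If \<open>S'\<close> tends to \<open>S0\<close>, then \<open>lam'\<close> tends to \<open>lam0\<close> by continuity of the branch; after
  normalising the initial data, Gronwall's inequality makes a subsequence of the \<open>y'\<close> converge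
  uniformly to an eigenfunction for \<open>S0\<close> and \<open>lam0\<close>, which is a multiple of \<open>y\<close> by simplicity.
  Dividing by the integral yields the derivative \<open>u^* H u\<close>. Neither existence for the Cauchy problem
  nor measurability of the inverse of \<open>P\<close> is needed, since all solutions come from the branch.
\<close>

subsection \<open>Indefinite integrals and Gronwall\<close>

text \<open>The identity of the overview is exact. With \<open>H = S' - S0\<close> and
  \<open>I = \<integral> y^* W y'\<close>, the error \<open>lam' - lam0 - u^* H u\<close> therefore
  equals \<open>u^* H (u' / I - u)\<close>, which is small relative to the norm of \<open>H\<close>
  as soon as \<open>u' / I\<close> tends to \<open>u\<close>: plain convergence of eigenfunctions,
  without a rate, already gives a derivative. The quotient \<open>u' / I\<close> does not change
  when \<open>y'\<close> is multiplied by a complex number, so the unknown scale and phase of the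
  perturbed eigenfunctions drop out. The obstacle is low regularity. The coefficients are merely
  essentially bounded and the equations hold almost everywhere, whereas limits pass through integral
  equations. Lebesgue differentiation links the two forms. Coercivity of \<open>P\<close> acts as a
  bounded inverse: it controls the derivative of \<open>y\<close> by the quasi-derivative
  \<open>z\<close>, and it forces the derivatives to converge pointwise once the quasi-derivatives
  do. Since all derivatives are essentially bounded, solutions are Lipschitz, and integration by
  parts reduces to a fundamental theorem for Lipschitz functions.\<close>

text \<open>\<open>integrable_ccontinuous_explicit\<close> speaks of averages over intervals to the
  right of a point. Applied to the zero extension of \<open>f\<close> and to its reflection, it
  yields both one-sided derivatives off a negligible set.\<close>

lemma indefinite_integral_has_vector_derivative_ae:
  fixes f :: "real \<Rightarrow> 'a::euclidean_space"
  assumes f: "f integrable_on {a..b}"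
  obtains N where "negligible N"
    "\<And>t. t \<in> {a<..<b} - N \<Longrightarrow> ((\<lambda>u. integral {a..u} f) has_vector_derivative f t) (at t)"
proof -
  \<comment> \<open>Extension by 0 gives integrability over every interval, which the
    differentiation theorem and the reflection ask for; inside \<open>{a<..<b}\<close> nothing
    changes.\<close>
  define F where "F = (\<lambda>x. if x \<in> {a..b} then f x else 0)"
  have F_UNIV: "F integrable_on UNIV"
    unfolding F_def using f Henstock_Kurzweil_Integration.integrable_restrict_UNIV by blast
  then have F: "F integrable_on cbox c d" for c d
    using integrable_on_subcbox by blast
  then have F': "(\<lambda>x. F (- x)) integrable_on cbox c d" for c d
    using Henstock_Kurzweil_Integration.integrable_reflect[of F "-c" "-d"] by simp
  obtain N1 where N1: "negligible N1" and
    right: "\<And>x e. \<lbrakk>x \<notin> N1; 0 < e\<rbrakk> \<Longrightarrow> \<exists>d>0. \<forall>h. 0 < h \<and> h < d \<longrightarrow>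
       norm (integral (cbox x (x + h *\<^sub>R One)) F /\<^sub>R h ^ DIM(real) - F x) < e"
    by (rule integrable_ccontinuous_explicit[OF F]) (rule that)
  obtain N2 where N2: "negligible N2" and
    left: "\<And>x e. \<lbrakk>x \<notin> N2; 0 < e\<rbrakk> \<Longrightarrow> \<exists>d>0. \<forall>h. 0 < h \<and> h < d \<longrightarrow>
       norm (integral (cbox x (x + h *\<^sub>R One)) (\<lambda>x. F (- x)) /\<^sub>R h ^ DIM(real) - F (- x)) < e"
    by (rule integrable_ccontinuous_explicit[OF F']) (rule that)
  show thesis
  proof
    have "linear (uminus :: real \<Rightarrow> real)" by (simp add: linear_iff)
    then show "negligible (N1 \<union> uminus ` N2)"
      using N1 N2 negligible_Un negligible_differentiable_image_negligible[of N2 uminus]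
        linear_imp_differentiable_on by (metis order_refl)
  next
    fix t assume t: "t \<in> {a<..<b} - (N1 \<union> uminus ` N2)"
    then have t1: "t \<notin> N1" and t2: "- t \<notin> N2" and tab: "a < t" "t < b"
      by (auto simp: image_iff)
    have Ft: "F t = f t" using tab by (simp add: F_def)
    have split: "integral {a..v} f - integral {a..u} f = integral {u..v} F"
      if "a < u" "u \<le> v" "v < b" for u v
    proof -
      have "integral {a..u} f + integral {u..v} f = integral {a..v} f"
        by (rule Henstock_Kurzweil_Integration.integral_combine)
           (use that in \<open>auto intro: integrable_subinterval_real[OF f]\<close>)
      moreover have "integral {u..v} f = integral {u..v} F"
        by (rule integral_cong) (use that in \<open>auto simp: F_def\<close>)
      ultimately show ?thesis by (metis add_diff_cancel_left')
    qed
    show "((\<lambda>u. integral {a..u} f) has_vector_derivative f t) (at t)"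
      unfolding has_vector_derivative_def has_derivative_at_alt
    proof (intro conjI allI impI)
      show "bounded_linear (\<lambda>x. x *\<^sub>R f t)" by (rule bounded_linear_scaleR_left)
      fix e :: real assume e: "0 < e"
      obtain d1 where d1: "d1 > 0" "\<And>h. 0 < h \<and> h < d1 \<Longrightarrow>
          norm (integral {t..t + h} F /\<^sub>R h - F t) < e"
        using right[OF t1 e] by auto
      obtain d2 where d2: "d2 > 0" "\<And>h. 0 < h \<and> h < d2 \<Longrightarrow>
          norm (integral {-t..-t + h} (\<lambda>x. F (- x)) /\<^sub>R h - F t) < e"
        using left[OF t2 e] by auto
      have scale: "norm (X - h *\<^sub>R F t) \<le> e * h" if "norm (X /\<^sub>R h - F t) < e" "0 < h" for X h
      proof -
        have "X - h *\<^sub>R F t = h *\<^sub>R (X /\<^sub>R h - F t)"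
          using that by (simp add: algebra_simps)
        then have "norm (X - h *\<^sub>R F t) = h * norm (X /\<^sub>R h - F t)"
          using that by simp
        then show ?thesis using that by (simp add: mult.commute)
      qed
      show "\<exists>d>0. \<forall>y. norm (y - t) < d \<longrightarrow>
          norm (integral {a..y} f - integral {a..t} f - (y - t) *\<^sub>R f t) \<le> e * norm (y - t)"
      proof (intro exI conjI allI impI)
        let ?d = "Min {d1, d2, t - a, b - t}"
        show "0 < ?d" using d1 d2 tab by simp
        fix y assume y: "norm (y - t) < ?d"
        then have y': "\<bar>y - t\<bar> < d1" "\<bar>y - t\<bar> < d2" "a < y" "y < b" by auto
        consider "y = t" | "y > t" | "y < t" by linarith
        then show "norm (integral {a..y} f - integral {a..t} f - (y - t) *\<^sub>R f t) \<le> e * norm (y - t)"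
        proof cases
          case 1 then show ?thesis by simp
        next
          case 2
          then have "norm (integral {t..y} F /\<^sub>R (y - t) - F t) < e"
            using d1(2)[of "y - t"] y' by auto
          from scale[OF this] show ?thesis
            using 2 split[of t y] y' tab Ft by simp
        next
          case 3
          \<comment> \<open>After reflection, an increment to the left of \<open>t\<close> is an
            average over an interval that starts at \<open>- t\<close>, where \<open>left\<close>
            applies.\<close>
          have "integral {-t..-y} (\<lambda>x. F (- x)) = integral {y..t} F"
            by (rule Henstock_Kurzweil_Integration.integral_reflect_real)
          then have "norm (integral {y..t} F /\<^sub>R (t - y) - F t) < e"
            using d2(2)[of "t - y"] y' 3 by auto
          from scale[OF this] have "norm (integral {y..t} F - (t - y) *\<^sub>R F t) \<le> e * (t - y)"
            using 3 by simp
          moreover have "integral {a..y} f - integral {a..t} f - (y - t) *\<^sub>R f t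
              = - (integral {y..t} F - (t - y) *\<^sub>R F t)"
            using 3 split[of y t] y' tab Ft by (simp add: algebra_simps)
          ultimately show ?thesis using 3 by (simp only: norm_minus_cancel) simp
        qed
      qed
    qed
  qed
qed

text \<open>The difference quotients of a Lipschitz function are bounded by \<open>L\<close> and
  converge almost everywhere to \<open>h\<close>, so dominated convergence applies, while their
  integrals telescope. The lemma serves the integration by parts in Lagrange's identity.\<close>

lemma Lipschitz_fundamental_theorem_of_calculus:
  fixes f :: "real \<Rightarrow> 'a::euclidean_space"
  assumes ab: "a \<le> b" and lip: "L-lipschitz_on {a..b} f" and N: "negligible N"
    and deriv: "\<And>t. t \<in> {a<..<b} - N \<Longrightarrow> (f has_vector_derivative h t) (at t)"
  shows "(h has_integral f b - f a) {a..b}"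
proof -
  \<comment> \<open>Clamping the argument to \<open>{a..b}\<close> is 1-Lipschitz, so
    \<open>g\<close> keeps the constant \<open>L\<close> while \<open>g (t + s k)\<close> makes
    sense beyond \<open>b\<close>.\<close>
  define g where "g = (\<lambda>t. f (max a (min b t)))"
  define s where "s = (\<lambda>k. inverse (real (Suc k)))"
  define q where "q = (\<lambda>k t. (g (t + s k) - g t) /\<^sub>R s k)"
  define N' where "N' = N \<union> {a, b}"
  have L0: "0 \<le> L" using lip lipschitz_on_def by blast
  have glip: "norm (g u - g v) \<le> L * \<bar>u - v\<bar>" for u v
  proof -
    have "norm (g u - g v) \<le> L * \<bar>max a (min b u) - max a (min b v)\<bar>"
      using lipschitz_onD[OF lip, of "max a (min b u)" "max a (min b v)"] ab
      by (auto simp: g_def dist_norm)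
    also have "\<dots> \<le> L * \<bar>u - v\<bar>"
      by (rule mult_left_mono) (use L0 in \<open>auto simp: max_def min_def\<close>)
    finally show ?thesis .
  qed
  have "L-lipschitz_on UNIV g"
    using glip L0 by (auto simp: lipschitz_on_def dist_norm)
  then have contg: "continuous_on S g" for S
    using lipschitz_on_continuous_on continuous_on_subset by blast
  have gint: "g integrable_on {u..v}" for u v
    by (rule integrable_continuous_real[OF contg])
  have s0: "s k > 0" for k by (simp add: s_def)
  have s_lim: "s \<longlonglongrightarrow> 0" unfolding s_def by (rule LIMSEQ_inverse_real_of_nat)
  \<comment> \<open>Translation by \<open>s k\<close> cancels the bulk of the two integrals and
    leaves strips of width \<open>s k\<close> at the ends; by \<open>mean\<close> below, their
    averages tend to \<open>g b\<close> and \<open>g a\<close>.\<close>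
  have intq: "(q k has_integral (integral {b..b + s k} g - integral {a..a + s k} g) /\<^sub>R s k) {a..b}" for k
  proof -
    have "(g has_integral integral {a + s k..b + s k} g) {a + s k..b + s k}"
      using gint by blast
    then have "((\<lambda>t. g (t + s k)) has_integral integral {a + s k..b + s k} g) {a..b}"
      by (subst (asm) has_integral_shift_real_ivl_iff[where c = "s k"]) simp
    moreover have "(g has_integral integral {a..b} g) {a..b}" using gint by blast
    ultimately have *: "(q k has_integral (integral {a + s k..b + s k} g - integral {a..b} g) /\<^sub>R s k) {a..b}"
      unfolding q_def by (intro has_integral_cmul has_integral_diff)
    have "integral {a..b} g + integral {b..b + s k} g = integral {a..b + s k} g"
      by (rule Henstock_Kurzweil_Integration.integral_combine) (use s0[of k] ab gint in auto)
    moreover have "integral {a..a + s k} g + integral {a + s k..b + s k} g = integral {a..b + s k} g"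
      by (rule Henstock_Kurzweil_Integration.integral_combine) (use s0[of k] ab gint in auto)
    ultimately have "integral {a + s k..b + s k} g - integral {a..b} g
        = integral {b..b + s k} g - integral {a..a + s k} g"
      by (metis (no_types, opaque_lifting) add_diff_cancel_left' add_diff_eq diff_add_eq diff_diff_eq2)
    with * show ?thesis by simp
  qed
  have mean: "(\<lambda>k. integral {c..c + s k} g /\<^sub>R s k) \<longlonglongrightarrow> g c" for c
  proof -
    have "norm (integral {c..c + s k} g /\<^sub>R s k - g c) \<le> L * s k" for k
    proof -
      have *: "integral {c..c + s k} (\<lambda>t. g t - g c) = integral {c..c + s k} g - s k *\<^sub>R g c"
        using s0[of k] gint by (subst Henstock_Kurzweil_Integration.integral_diff) (auto simp: integrable_const_ivl)
      have "norm (integral {c..c + s k} (\<lambda>t. g t - g c)) \<le> L * s k * (c + s k - c)"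
      proof (rule integral_bound)
        show "continuous_on {c..c + s k} (\<lambda>t. g t - g c)" by (intro continuous_intros contg)
        show "norm (g t - g c) \<le> L * s k" if "t \<in> {c..c + s k}" for t
        proof -
          have "L * \<bar>t - c\<bar> \<le> L * s k" using that L0 by (intro mult_left_mono) auto
          then show ?thesis using glip[of t c] by linarith
        qed
      qed (use s0[of k] in auto)
      then have "norm (integral {c..c + s k} g - s k *\<^sub>R g c) / s k \<le> L * s k"
        unfolding * using s0[of k] by (simp add: pos_divide_le_eq)
      then have "norm ((integral {c..c + s k} g - s k *\<^sub>R g c) /\<^sub>R s k) \<le> L * s k"
        using s0[of k] by (simp only: norm_scaleR) (simp add: divide_inverse mult.commute)
      then show ?thesis using s0[of k] by (simp add: scaleR_diff_right)
    qed
    then have le: "\<forall>k. norm (integral {c..c + s k} g /\<^sub>R s k - g c) \<le> L * s k" by blast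
    have "(\<lambda>k. L * s k) \<longlonglongrightarrow> 0" using tendsto_mult_right_zero[OF s_lim] by simp
    then have "(\<lambda>k. integral {c..c + s k} g /\<^sub>R s k - g c) \<longlonglongrightarrow> 0"
      by (rule Lim_null_comparison[OF always_eventually[OF le]])
    then show ?thesis by (rule LIM_zero_cancel)
  qed
  have N': "negligible N'" unfolding N'_def using N by auto
  \<comment> \<open>Dominated convergence is stated with convergence at every point, so quotients
    and limit are set to 0 on the exceptional set. That set contains the endpoints because
    \<open>deriv\<close> covers only the open interval.\<close>
  define q' where "q' = (\<lambda>k t. if t \<in> N' then 0 else q k t)"
  define h' where "h' = (\<lambda>t. if t \<in> N' then 0 else h t)"
  have "(h' has_integral g b - g a) {a..b}"
  proof (rule has_integral_dominated_convergence)
    show "(q' k has_integral (integral {b..b + s k} g - integral {a..a + s k} g) /\<^sub>R s k) {a..b}" for k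
      by (rule has_integral_spike[OF N' _ intq]) (auto simp: q'_def)
    show "(\<lambda>t. L) integrable_on {a..b}" by (rule integrable_const_ivl)
    show "\<forall>t\<in>{a..b}. norm (q' k t) \<le> L" for k
    proof
      fix t
      have "norm (g (t + s k) - g t) \<le> L * s k" using glip[of "t + s k" t] s0[of k] by simp
      then have "norm (g (t + s k) - g t) / s k \<le> L" using s0[of k] by (simp add: pos_divide_le_eq)
      moreover have "norm (q k t) = norm (g (t + s k) - g t) / s k"
        unfolding q_def norm_scaleR using s0[of k] by (simp add: divide_inverse mult.commute)
      ultimately show "norm (q' k t) \<le> L" using L0 by (simp add: q'_def)
    qed
    show "\<forall>t\<in>{a..b}. (\<lambda>k. q' k t) \<longlonglongrightarrow> h' t"
    proof
      fix t assume t: "t \<in> {a..b}"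
      show "(\<lambda>k. q' k t) \<longlonglongrightarrow> h' t"
      proof (cases "t \<in> N'")
        case True then show ?thesis by (simp add: q'_def h'_def)
      next
        case False
        then have tab: "t \<in> {a<..<b} - N" using t by (auto simp: N'_def)
        have "(g has_vector_derivative h t) (at t)"
          by (rule has_vector_derivative_transform_within_open[OF deriv[OF tab], of "{a<..<b}"])
             (use tab in \<open>auto simp: g_def max_def min_def\<close>)
        then have lim: "(\<lambda>u. norm (g (t + u) - g t - u *\<^sub>R h t) / norm u) \<midarrow>0\<rightarrow> 0"
          unfolding has_vector_derivative_def has_derivative_at by blast
        have "filterlim s (at 0) sequentially"
          unfolding filterlim_at using s0 s_lim by (auto simp: less_imp_neq[symmetric])
        from filterlim_compose[OF lim this]
        have "(\<lambda>k. norm (g (t + s k) - g t - s k *\<^sub>R h t) / norm (s k)) \<longlonglongrightarrow> 0" .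
        moreover have "norm (g (t + s k) - g t - s k *\<^sub>R h t) / norm (s k) = norm (q k t - h t)" for k
        proof -
          have "q k t - h t = (g (t + s k) - g t - s k *\<^sub>R h t) /\<^sub>R s k"
            using s0[of k] by (simp add: q_def scaleR_diff_right)
          then show ?thesis using s0[of k] by (simp add: divide_inverse mult.commute)
        qed
        ultimately have "(\<lambda>k. q k t) \<longlonglongrightarrow> h t"
          by (simp add: LIM_zero_iff tendsto_norm_zero_iff)
        then show ?thesis using False by (simp add: q'_def h'_def)
      qed
    qed
    show "(\<lambda>k. (integral {b..b + s k} g - integral {a..a + s k} g) /\<^sub>R s k) \<longlonglongrightarrow> g b - g a"
      using tendsto_diff[OF mean[of b] mean[of a]] by (simp add: scaleR_diff_right)
  qed
  then have "(h has_integral g b - g a) {a..b}"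
    by (rule has_integral_spike[OF N', rotated]) (auto simp: h'_def)
  then show ?thesis using ab by (simp add: g_def)
qed

text \<open>The hypothesis makes the derivative of
  \<open>(A + C * \<integral> f) * exp (- C * (t - a))\<close> nonpositive; comparing its values at
  \<open>t\<close> and at \<open>a\<close> gives the bound.\<close>

lemma Gronwall_integral:
  fixes f :: "real \<Rightarrow> real"
  assumes ab: "a \<le> b" and C: "0 \<le> C" and cont: "continuous_on {a..b} f"
    and le: "\<And>t. t \<in> {a..b} \<Longrightarrow> f t \<le> A + C * integral {a..t} f"
    and t: "t \<in> {a..b}"
  shows "f t \<le> A * exp (C * (t - a))"
proof -
  define G where "G = (\<lambda>t. (A + C * integral {a..t} f) * exp (- C * (t - a)))"
  have "G t \<le> G a"
  proof (rule DERIV_nonpos_imp_decreasing_open[of a t G])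
    show "a \<le> t" using t by simp
    show "continuous_on {a..t} G"
      unfolding G_def
      by (intro continuous_intros indefinite_integral_continuous_1 integrable_continuous_real
          continuous_on_subset[OF cont]) (use t in auto)
  next
    fix x assume x: "a < x" "x < t"
    have "((\<lambda>u. integral {a..u} f) has_real_derivative f x) (at x within {a..b})"
      by (rule integral_has_real_derivative[OF cont]) (use x t in auto)
    then have d: "((\<lambda>u. integral {a..u} f) has_real_derivative f x) (at x)"
      using x t at_within_Icc_at[of a x b] by simp
    have "(G has_real_derivative (C * f x) * exp (- C * (x - a))
        + (A + C * integral {a..x} f) * (- C * exp (- C * (x - a)))) (at x)"
    proof -
      have "((\<lambda>t. exp (- C * (t - a))) has_real_derivative - C * exp (- C * (x - a))) (at x)"
        by (auto intro!: derivative_eq_intros)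
      from DERIV_mult[OF DERIV_add[OF DERIV_const DERIV_cmult[OF d]] this, of A C]
      show ?thesis unfolding G_def by (simp add: mult.commute add.commute)
    qed
    moreover have "(C * f x) * exp (- C * (x - a))
        + (A + C * integral {a..x} f) * (- C * exp (- C * (x - a)))
        = C * exp (- C * (x - a)) * (f x - (A + C * integral {a..x} f))"
      by (simp add: algebra_simps)
    moreover have "\<dots> \<le> 0"
      by (rule mult_nonneg_nonpos) (use C le[of x] x t in auto)
    ultimately show "\<exists>y. (G has_real_derivative y) (at x) \<and> y \<le> 0" by metis
  qed
  then have "(A + C * integral {a..t} f) * exp (- C * (t - a)) \<le> A"
    by (simp add: G_def)
  then have "A + C * integral {a..t} f \<le> A * exp (C * (t - a))"
    by (simp add: exp_minus divide_inverse[symmetric] pos_divide_le_eq)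
  then show ?thesis using le[OF t] by linarith
qed

text \<open>The inhomogeneity \<open>D\<close> is there for comparing solutions with different
  eigenvalue parameters; over the whole interval it adds at most \<open>D * (b - a)\<close> to the
  constant of the scalar inequality.\<close>

lemma Gronwall_vector:
  fixes x :: "real \<Rightarrow> 'a::euclidean_space"
  assumes ab: "a \<le> b" and C: "0 \<le> C" and D: "0 \<le> D"
    and g: "g integrable_on {a..b}"
    and x: "\<And>t. t \<in> {a..b} \<Longrightarrow> x t = x a + integral {a..t} g"
    and N: "negligible N"
    and le: "\<And>t. t \<in> {a..b} - N \<Longrightarrow> norm (g t) \<le> C * norm (x t) + D"
    and t: "t \<in> {a..b}"
  shows "norm (x t) \<le> (norm (x a) + D * (b - a)) * exp (C * (b - a))"
proof -
  \<comment> \<open>With value 0 on \<open>N\<close> the bound holds at every point, because its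
    right-hand side is nonnegative.\<close>
  define g' where "g' = (\<lambda>t. if t \<in> N then 0 else g t)"
  have "continuous_on {a..b} (\<lambda>t. x a + integral {a..t} g)"
    by (intro continuous_intros indefinite_integral_continuous_1 g)
  then have cont: "continuous_on {a..b} x"
    by (rule continuous_on_eq) (simp only: x)
  have nint: "(\<lambda>t. norm (x t)) integrable_on {a..u}" if "u \<in> {a..b}" for u
    by (intro integrable_continuous_real continuous_on_norm continuous_on_subset[OF cont]) (use that in auto)
  have main: "norm (x u) \<le> (norm (x a) + D * (b - a)) + C * integral {a..u} (\<lambda>t. norm (x t))"
    if u: "u \<in> {a..b}" for u
  proof -
    have "integral {a..u} g = integral {a..u} g'"
      by (rule integral_spike[OF N]) (auto simp: g'_def)
    moreover have "norm (integral {a..u} g') \<le> integral {a..u} (\<lambda>t. C * norm (x t) + D)"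
    proof (rule integral_norm_bound_integral)
      have "g integrable_on {a..u}" by (rule integrable_subinterval_real[OF g]) (use u in auto)
      then show "g' integrable_on {a..u}"
        by (rule integrable_spike[OF _ N]) (auto simp: g'_def)
      show "(\<lambda>t. C * norm (x t) + D) integrable_on {a..u}"
        using integrable_add[OF integrable_on_cmult_left[OF nint[OF u], of C] integrable_const_ivl[of D a u]]
        by simp
      show "norm (g' t) \<le> C * norm (x t) + D" if "t \<in> {a..u}" for t
        using le[of t] that u C D by (auto simp: g'_def)
    qed
    moreover have "integral {a..u} (\<lambda>t. C * norm (x t) + D)
        = C * integral {a..u} (\<lambda>t. norm (x t)) + D * (u - a)"
      using nint[OF u] u
      by (subst Henstock_Kurzweil_Integration.integral_add)
         (auto intro: integrable_const_ivl integrable_on_cmult_left[where 'b=real, simplified])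
    moreover have "D * (u - a) \<le> D * (b - a)" using u D by (intro mult_left_mono) auto
    ultimately show ?thesis
      using x[OF u] norm_triangle_ineq[of "x a" "integral {a..u} g"] by simp
  qed
  have "norm (x t) \<le> (norm (x a) + D * (b - a)) * exp (C * (t - a))"
    by (rule Gronwall_integral[OF ab C continuous_on_norm[OF cont] main t])
  also have "\<dots> \<le> (norm (x a) + D * (b - a)) * exp (C * (b - a))"
    using t C D ab by (intro mult_left_mono) (auto intro: mult_left_mono)
  finally show ?thesis .
qed

subsection \<open>Hermitian forms and matrix bounds\<close>

text \<open>Bridge between the measure-theoretic hypotheses on the coefficients and the gauge
  integral lemmas, whose exceptional sets are negligible sets.\<close>

lemma AE_lebesgue_on_iff_negligible:
  "(AE t in lebesgue_on {a..b::real}. R t) \<longleftrightarrow> (\<exists>N. negligible N \<and> (\<forall>t\<in>{a..b} - N. R t))"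
proof -
  let ?S = "{a..b}"
  have "(AE t in lebesgue_on ?S. R t) \<longleftrightarrow> (AE t in lebesgue. t \<in> ?S \<longrightarrow> R t)"
    by (rule AE_restrict_space_iff) auto
  also have "\<dots> \<longleftrightarrow> (\<exists>N\<in>null_sets lebesgue. {t. \<not> (t \<in> ?S \<longrightarrow> R t)} \<subseteq> N)"
    by (simp add: eventually_ae_filter)
  also have "\<dots> \<longleftrightarrow> (\<exists>N. negligible N \<and> (\<forall>t\<in>?S - N. R t))"
    unfolding negligible_iff_null_sets by blast
  finally show ?thesis .
qed

text \<open>The class inner product on \<open>complex^'m\<close> is real valued: it is the real part
  of this form. The complex value is kept because eigenfunctions are determined only up to complex
  factors.\<close>

definition hdot :: "complex^'m \<Rightarrow> complex^'m \<Rightarrow> complex" where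
  "hdot x y = (\<Sum>i\<in>UNIV. cnj (x $ i) * y $ i)"

text \<open>Sesquilinear over the complex numbers, the form is bilinear over the reals, which makes
  the product rule, limits and norm bounds of \<open>bounded_bilinear\<close> available.\<close>

lemma bounded_bilinear_hdot: "bounded_bilinear (hdot :: complex^'m \<Rightarrow> complex^'m \<Rightarrow> complex)"
proof
  show "\<exists>K. \<forall>a b. norm (hdot a b :: complex) \<le> norm a * norm (b :: complex^'m) * K"
  proof (intro exI allI)
    fix x y :: "complex^'m"
    have "norm (hdot x y) \<le> (\<Sum>i\<in>(UNIV :: 'm set). norm x * norm y)"
      unfolding hdot_def
    proof (rule sum_norm_le)
      show "norm (cnj (x $ i) * y $ i) \<le> norm x * norm y" for i
        by (simp add: norm_mult mult_mono Finite_Cartesian_Product.norm_nth_le)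
    qed
    then show "norm (hdot x y) \<le> norm x * norm y * real CARD('m)"
      by (simp add: mult.commute)
  qed
qed (auto simp: hdot_def algebra_simps sum.distrib scaleR_sum_right)

interpretation hdot: bounded_bilinear "hdot :: complex^'m \<Rightarrow> complex^'m \<Rightarrow> complex"
  by (rule bounded_bilinear_hdot)

lemma hdot_scale_right: "hdot x (c *s y) = c * hdot x y"
  by (simp add: hdot_def sum_distrib_left ac_simps)

lemma hdot_scale_left: "hdot (c *s x) y = cnj c * hdot x y"
  by (simp add: hdot_def sum_distrib_left ac_simps)

lemma norm_vector_scale: "norm (c *s (x :: complex^'m)) = norm c * norm x"
  by (simp add: norm_vec_def norm_mult L2_set_right_distrib)

text \<open>The factor counts entries and is far from sharp; entrywise bounds are the form in which
  essential boundedness of a matrix function is given.\<close>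

lemma norm_matrix_vector_mult_le_entries:
  fixes A :: "complex^'n^'m"
  assumes A: "\<And>i j. norm (A $ i $ j) \<le> C"
  shows "norm (A *v x) \<le> real CARD('m) * real CARD('n) * C * norm x"
proof -
  have "norm (A *v x) \<le> (\<Sum>i\<in>UNIV. norm ((A *v x) $ i))"
    unfolding norm_vec_def by (rule L2_set_le_sum) simp
  also have "\<dots> \<le> (\<Sum>i\<in>(UNIV :: 'm set). real CARD('n) * (C * norm x))"
  proof (rule sum_mono)
    fix i
    have "norm ((A *v x) $ i) \<le> (\<Sum>j\<in>(UNIV :: 'n set). C * norm x)"
      unfolding matrix_vector_mult_def vec_lambda_beta
    proof (rule sum_norm_le)
      show "norm (A $ i $ j * x $ j) \<le> C * norm x" for j
        unfolding norm_mult
        by (intro mult_mono A Finite_Cartesian_Product.norm_nth_le norm_ge_zero order_trans[OF norm_ge_zero A])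
    qed
    then show "norm ((A *v x) $ i) \<le> real CARD('n) * (C * norm x)" by simp
  qed
  also have "\<dots> = real CARD('m) * real CARD('n) * C * norm x" by simp
  finally show ?thesis .
qed

lemma norm_matrix_vector_mult_le:
  fixes A :: "complex^'n^'m"
  shows "norm (A *v x) \<le> real CARD('m) * real CARD('n) * norm A * norm x"
  by (rule norm_matrix_vector_mult_le_entries) (meson Finite_Cartesian_Product.norm_nth_le order_trans)

lemma hdot_cmat_symmetric:
  assumes "transpose M = M"
  shows "hdot (cmat M *v x) y = hdot x (cmat M *v y)"
proof -
  have M: "M $ i $ j = M $ j $ i" for i j
    by (metis assms transpose_def vec_lambda_beta)
  have "hdot (cmat M *v x) y
      = (\<Sum>i\<in>UNIV. \<Sum>j\<in>UNIV. of_real (M $ i $ j) * cnj (x $ j) * y $ i)"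
    by (simp add: hdot_def cmat_def matrix_vector_mult_def sum_distrib_right sum_distrib_left)
  also have "\<dots> = (\<Sum>j\<in>UNIV. \<Sum>i\<in>UNIV. of_real (M $ i $ j) * cnj (x $ j) * y $ i)"
    by (rule sum.swap)
  also have "\<dots> = hdot x (cmat M *v y)"
    by (simp add: hdot_def cmat_def matrix_vector_mult_def sum_distrib_right sum_distrib_left
        M[of _ "_ :: 'a"] ac_simps)
  finally show ?thesis .
qed

lemma hdot_hermitian:
  assumes "hermitian S"
  shows "hdot (S *v x) y = hdot x (S *v y)"
proof -
  have S: "cnj (S $ i $ j) = S $ j $ i" for i j
    using assms unfolding hermitian_def by (metis complex_cnj_cnj)
  have "hdot (S *v x) y = (\<Sum>i\<in>UNIV. \<Sum>j\<in>UNIV. S $ j $ i * cnj (x $ j) * y $ i)"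
    by (simp add: hdot_def matrix_vector_mult_def sum_distrib_right sum_distrib_left S)
  also have "\<dots> = (\<Sum>j\<in>UNIV. \<Sum>i\<in>UNIV. S $ j $ i * cnj (x $ j) * y $ i)"
    by (rule sum.swap)
  also have "\<dots> = hdot x (S *v y)"
    by (simp add: hdot_def matrix_vector_mult_def sum_distrib_right sum_distrib_left ac_simps)
  finally show ?thesis .
qed

text \<open>For \<open>x = p + i q\<close> with real \<open>p\<close> and \<open>q\<close>, the real
  part of the form at \<open>x\<close> is the sum of the forms at \<open>p\<close> and at
  \<open>q\<close>; Cauchy-Schwarz then turns positivity into a lower bound. It takes the place of
  the bound \<open>1 / \<mu>\<close> for the inverse matrix.\<close>

lemma cmat_coercive:
  fixes M :: "real^'n^'n" and x :: "complex^'n"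
  assumes pos: "\<And>x::real^'n. \<mu> * (x \<bullet> x) \<le> x \<bullet> (M *v x)"
  shows "\<mu> * norm x \<le> norm (cmat M *v x)"
proof -
  define p q where "p = (\<chi> i. Re (x $ i))" and "q = (\<chi> i. Im (x $ i))"
  have "x \<bullet> x = p \<bullet> p + q \<bullet> q"
    by (simp add: inner_vec_def inner_complex_def p_def q_def sum.distrib)
  moreover have "x \<bullet> (cmat M *v x) = p \<bullet> (M *v p) + q \<bullet> (M *v q)"
    by (simp add: inner_vec_def inner_complex_def p_def q_def sum.distrib cmat_def
        matrix_vector_mult_def)
  ultimately have "\<mu> * (x \<bullet> x) \<le> x \<bullet> (cmat M *v x)"
    using pos[of p] pos[of q] by (simp add: algebra_simps)
  also have "\<dots> \<le> norm x * norm (cmat M *v x)" by (rule norm_cauchy_schwarz)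
  finally have "norm x * (\<mu> * norm x) \<le> norm x * norm (cmat M *v x)"
    by (simp add: dot_square_norm power2_eq_square ac_simps)
  then show ?thesis by (cases "x = 0") auto
qed

lemma sym_Linf_ae:
  fixes M :: "real \<Rightarrow> real^'n^'n"
  assumes "sym_Linf a b M"
  obtains N C where "negligible N" "0 \<le> C"
    "\<And>t. t \<in> {a..b} - N \<Longrightarrow> transpose (M t) = M t"
    "\<And>t x. t \<in> {a..b} - N \<Longrightarrow> norm (cmat (M t) *v x) \<le> C * norm x"
proof -
  have "\<exists>N. negligible N \<and> (\<exists>C. \<forall>t\<in>{a..b} - N. \<bar>M t $ i $ j\<bar> \<le> C)" for i j
  proof -
    have "\<exists>C. AE t in lebesgue_on {a..b}. \<bar>M t $ i $ j\<bar> \<le> C"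
      using assms by (simp add: sym_Linf_def Linf_on_def)
    then show ?thesis unfolding AE_lebesgue_on_iff_negligible by blast
  qed
  then obtain N C where N: "\<And>i j. negligible (N i j)"
    and C: "\<And>i j t. t \<in> {a..b} - N i j \<Longrightarrow> \<bar>M t $ i $ j\<bar> \<le> C i j" by metis
  obtain N0 where N0: "negligible N0" "\<And>t. t \<in> {a..b} - N0 \<Longrightarrow> transpose (M t) = M t"
    using assms by (auto simp: sym_Linf_def AE_lebesgue_on_iff_negligible)
  \<comment> \<open>The sum of absolute values is nonnegative and dominates the constant of every
    entry.\<close>
  define B where "B = (\<Sum>i\<in>UNIV. \<Sum>j\<in>UNIV. \<bar>C i j\<bar>)"
  have CB: "C i j \<le> B" for i j
  proof -
    have "\<bar>C i j\<bar> \<le> (\<Sum>j\<in>UNIV. \<bar>C i j\<bar>)"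
      by (rule member_le_sum) auto
    also have "\<dots> \<le> B" unfolding B_def
      by (rule member_le_sum[of i UNIV "\<lambda>i. \<Sum>j\<in>UNIV. \<bar>C i j\<bar>"]) (auto intro: sum_nonneg)
    finally show ?thesis by simp
  qed
  show thesis
  proof
    show "negligible (N0 \<union> (\<Union>i. \<Union>j. N i j))"
      using N N0 by (intro negligible_Un negligible_Union) (auto intro!: negligible_Union)
    show "0 \<le> real CARD('n) * real CARD('n) * B"
      unfolding B_def by (intro mult_nonneg_nonneg sum_nonneg) auto
    show "transpose (M t) = M t" if "t \<in> {a..b} - (N0 \<union> (\<Union>i. \<Union>j. N i j))" for t
      using that N0 by auto
    show "norm (cmat (M t) *v x) \<le> real CARD('n) * real CARD('n) * B * norm x"
      if t: "t \<in> {a..b} - (N0 \<union> (\<Union>i. \<Union>j. N i j))" for t and x :: "complex^'n"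
    proof (rule norm_matrix_vector_mult_le_entries)
      show "norm (cmat (M t) $ i $ j) \<le> B" for i j
        using C[of t i j] CB[of i j] t by (auto simp: cmat_def)
    qed
  qed
qed

lemma in_Omega_ae:
  fixes P Q W :: "real \<Rightarrow> real^'n^'n"
  assumes "in_Omega a b P Q W"
  obtains N \<mu> C where "negligible N" "0 < \<mu>" "0 \<le> C"
    "\<And>t. t \<in> {a..b} - N \<Longrightarrow> transpose (P t) = P t"
    "\<And>t. t \<in> {a..b} - N \<Longrightarrow> transpose (Q t) = Q t"
    "\<And>t. t \<in> {a..b} - N \<Longrightarrow> transpose (W t) = W t"
    "\<And>t x. t \<in> {a..b} - N \<Longrightarrow> \<mu> * norm x \<le> norm (cmat (P t) *v x)"
    "\<And>t x. t \<in> {a..b} - N \<Longrightarrow> norm (cmat (Q t) *v x) \<le> C * norm x"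
    "\<And>t x. t \<in> {a..b} - N \<Longrightarrow> norm (cmat (W t) *v x) \<le> C * norm x"
proof -
  have M: "sym_Linf a b P" "sym_Linf a b Q" "sym_Linf a b W" "unif_pos a b P"
    using assms by (auto simp: in_Omega_def)
  obtain N1 C1 where 1: "negligible N1" "0 \<le> C1"
    "\<And>t. t \<in> {a..b} - N1 \<Longrightarrow> transpose (P t) = P t"
    "\<And>t x. t \<in> {a..b} - N1 \<Longrightarrow> norm (cmat (P t) *v x) \<le> C1 * norm x"
    using sym_Linf_ae[OF M(1)] by metis
  obtain N2 C2 where 2: "negligible N2" "0 \<le> C2"
    "\<And>t. t \<in> {a..b} - N2 \<Longrightarrow> transpose (Q t) = Q t"
    "\<And>t x. t \<in> {a..b} - N2 \<Longrightarrow> norm (cmat (Q t) *v x) \<le> C2 * norm x"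
    using sym_Linf_ae[OF M(2)] by metis
  obtain N3 C3 where 3: "negligible N3" "0 \<le> C3"
    "\<And>t. t \<in> {a..b} - N3 \<Longrightarrow> transpose (W t) = W t"
    "\<And>t x. t \<in> {a..b} - N3 \<Longrightarrow> norm (cmat (W t) *v x) \<le> C3 * norm x"
    using sym_Linf_ae[OF M(3)] by metis
  obtain N4 \<mu> where 4: "negligible N4" "0 < \<mu>"
    "\<And>t x. t \<in> {a..b} - N4 \<Longrightarrow> \<mu> * (x \<bullet> x) \<le> x \<bullet> (P t *v x)"
    using M(4) by (auto simp: unif_pos_def AE_lebesgue_on_iff_negligible)
  let ?C = "C1 + C2 + C3"
  have C: "C1 * norm x \<le> ?C * norm x" "C2 * norm x \<le> ?C * norm x" "C3 * norm x \<le> ?C * norm x"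
    for x :: "complex^'n"
    using 1(2) 2(2) 3(2) by (auto intro!: mult_right_mono)
  show thesis
  proof
    show "negligible (N1 \<union> N2 \<union> N3 \<union> N4)" using 1 2 3 4 by auto
    show "0 < \<mu>" by fact
    show "0 \<le> ?C" using 1 2 3 by simp
    fix t assume "t \<in> {a..b} - (N1 \<union> N2 \<union> N3 \<union> N4)"
    then have t: "t \<in> {a..b} - N1" "t \<in> {a..b} - N2" "t \<in> {a..b} - N3" "t \<in> {a..b} - N4" by auto
    show "transpose (P t) = P t" "transpose (Q t) = Q t" "transpose (W t) = W t"
      using 1 2 3 t by auto
    fix x :: "complex^'n"
    show "\<mu> * norm x \<le> norm (cmat (P t) *v x)" using cmat_coercive 4 t by blast
    show "norm (cmat (Q t) *v x) \<le> ?C * norm x" using 2(4)[OF t(2)] C(2) order_trans by blast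
    show "norm (cmat (W t) *v x) \<le> ?C * norm x" using 3(4)[OF t(3)] C(3) order_trans by blast
  qed
qed

subsection \<open>Integral form of the equation and compactness of solutions\<close>

text \<open>The densities \<open>v\<close> of \<open>y\<close> and \<open>w\<close> of
  \<open>z\<close> are named explicitly. Integral equations survive limits under a common bound on
  the densities, which almost everywhere derivatives alone do not, and only values on
  \<open>{a..b}\<close> enter.\<close>

definition sl_integral_solution where
  "sl_integral_solution a b P Q W lam y z v w \<longleftrightarrow>
     v absolutely_integrable_on {a..b} \<and> w absolutely_integrable_on {a..b} \<and>
     (\<forall>t\<in>{a..b}. y t = y a + integral {a..t} v) \<and>
     (\<forall>t\<in>{a..b}. z t = z a + integral {a..t} w) \<and>
     (\<exists>N. negligible N \<and> (\<forall>t\<in>{a..b} - N. z t = cmat (P t) *v v t \<and>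
        w t = cmat (Q t) *v y t - complex_of_real lam *s (cmat (W t) *v y t)))"

lemma indefinite_integral_ae_derivative:
  fixes f :: "real \<Rightarrow> 'a::euclidean_space"
  assumes g: "g integrable_on {a..b}" and f: "\<And>t. t \<in> {a..b} \<Longrightarrow> f t = f a + integral {a..t} g"
  obtains N where "negligible N"
    "\<And>t. t \<in> {a<..<b} - N \<Longrightarrow> (f has_vector_derivative g t) (at t)"
proof -
  obtain N where N: "negligible N"
    "\<And>t. t \<in> {a<..<b} - N \<Longrightarrow> ((\<lambda>u. integral {a..u} g) has_vector_derivative g t) (at t)"
    by (rule indefinite_integral_has_vector_derivative_ae[OF g]) (rule that)
  show thesis
  proof (rule that[OF N(1)])
    fix t assume t: "t \<in> {a<..<b} - N"
    have "((\<lambda>u. f a + integral {a..u} g) has_vector_derivative g t) (at t)"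
      using has_vector_derivative_add[OF has_vector_derivative_const N(2)[OF t]] by simp
    then show "(f has_vector_derivative g t) (at t)"
      by (rule has_vector_derivative_transform_within_open[of _ _ _ "{a<..<b}"])
         (use t in \<open>auto simp only: f[symmetric] greaterThanLessThan_subseteq_atLeastAtMost_iff
            open_greaterThanLessThan Diff_iff greaterThanLessThan_iff atLeastAtMost_iff less_imp_le\<close>)
  qed
qed

lemma sl_integral_solution_derivatives:
  fixes y z :: "real \<Rightarrow> complex^'n"
  assumes "sl_integral_solution a b P Q W lam y z v w"
  obtains N where "negligible N"
    "\<And>t. t \<in> {a..b} - N \<Longrightarrow> t \<in> {a<..<b}"
    "\<And>t. t \<in> {a..b} - N \<Longrightarrow> (y has_vector_derivative v t) (at t)"
    "\<And>t. t \<in> {a..b} - N \<Longrightarrow> (z has_vector_derivative w t) (at t)"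
    "\<And>t. t \<in> {a..b} - N \<Longrightarrow> z t = cmat (P t) *v v t"
    "\<And>t. t \<in> {a..b} - N \<Longrightarrow>
       w t = cmat (Q t) *v y t - complex_of_real lam *s (cmat (W t) *v y t)"
proof -
  note sol = assms[unfolded sl_integral_solution_def]
  have v: "v integrable_on {a..b}" and w: "w integrable_on {a..b}"
    using sol set_lebesgue_integral_eq_integral(1) by blast+
  have y: "\<And>t. t \<in> {a..b} \<Longrightarrow> y t = y a + integral {a..t} v"
    and z: "\<And>t. t \<in> {a..b} \<Longrightarrow> z t = z a + integral {a..t} w"
    using sol by blast+
  obtain N where N: "negligible N" "\<And>t. t \<in> {a..b} - N \<Longrightarrow> z t = cmat (P t) *v v t"
    "\<And>t. t \<in> {a..b} - N \<Longrightarrow>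
       w t = cmat (Q t) *v y t - complex_of_real lam *s (cmat (W t) *v y t)"
    using sol by blast
  obtain N1 where N1: "negligible N1"
    "\<And>t. t \<in> {a<..<b} - N1 \<Longrightarrow> (y has_vector_derivative v t) (at t)"
    by (rule indefinite_integral_ae_derivative[OF v y]) (assumption, rule that)
  obtain N2 where N2: "negligible N2"
    "\<And>t. t \<in> {a<..<b} - N2 \<Longrightarrow> (z has_vector_derivative w t) (at t)"
    by (rule indefinite_integral_ae_derivative[OF w z]) (assumption, rule that)
  show thesis
  proof
    \<comment> \<open>The endpoints join the exceptional set, since the two-sided derivatives come
      from the open interval.\<close>
    show "negligible (N \<union> N1 \<union> N2 \<union> {a, b})" using N N1 N2 by auto
    fix t assume t: "t \<in> {a..b} - (N \<union> N1 \<union> N2 \<union> {a, b})"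
    then show *: "t \<in> {a<..<b}" by auto
    show "(y has_vector_derivative v t) (at t)" "(z has_vector_derivative w t) (at t)"
      using t * N1 N2 by auto
    show "z t = cmat (P t) *v v t"
      "w t = cmat (Q t) *v y t - complex_of_real lam *s (cmat (W t) *v y t)"
      using t N by auto
  qed
qed

text \<open>From left to right, absolute continuity supplies densities, Lebesgue differentiation
  makes them derivatives almost everywhere, and uniqueness of derivatives identifies them with those
  in the equations. The converse uses the same differentiation.\<close>

lemma sl_solution_iff_integral:
  fixes y z :: "real \<Rightarrow> complex^'n"
  shows "sl_solution a b P Q W lam y z \<longleftrightarrow> (\<exists>v w. sl_integral_solution a b P Q W lam y z v w)"
proof
  assume "sl_solution a b P Q W lam y z"
  note sol = this[unfolded sl_solution_def abs_cont_on_def]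
  obtain v where v: "v absolutely_integrable_on {a..b}"
    "\<forall>t\<in>{a..b}. y t = y a + integral {a..t} v" using sol by blast
  obtain w where w: "w absolutely_integrable_on {a..b}"
    "\<forall>t\<in>{a..b}. z t = z a + integral {a..t} w" using sol by blast
  have vi: "v integrable_on {a..b}" and wi: "w integrable_on {a..b}"
    using v w set_lebesgue_integral_eq_integral(1) by blast+
  have y: "\<And>t. t \<in> {a..b} \<Longrightarrow> y t = y a + integral {a..t} v"
    and z: "\<And>t. t \<in> {a..b} \<Longrightarrow> z t = z a + integral {a..t} w"
    using v w by blast+
  obtain N1 where N1: "negligible N1"
    "\<And>t. t \<in> {a<..<b} - N1 \<Longrightarrow> (y has_vector_derivative v t) (at t)"
    by (rule indefinite_integral_ae_derivative[OF vi y]) (assumption, rule that)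
  obtain N2 where N2: "negligible N2"
    "\<And>t. t \<in> {a<..<b} - N2 \<Longrightarrow> (z has_vector_derivative w t) (at t)"
    by (rule indefinite_integral_ae_derivative[OF wi z]) (assumption, rule that)
  obtain N3 where N3: "negligible N3" "\<And>t. t \<in> {a..b} - N3 \<Longrightarrow>
      \<exists>v. (y has_vector_derivative v) (at t) \<and> z t = cmat (P t) *v v"
    using sol unfolding AE_lebesgue_on_iff_negligible by blast
  obtain N4 where N4: "negligible N4" "\<And>t. t \<in> {a..b} - N4 \<Longrightarrow>
      (z has_vector_derivative (cmat (Q t) *v y t - complex_of_real lam *s (cmat (W t) *v y t))) (at t)"
    using sol unfolding AE_lebesgue_on_iff_negligible by blast
  let ?N = "N1 \<union> N2 \<union> N3 \<union> N4 \<union> {a, b}"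
  have "negligible ?N" using N1 N2 N3 N4 by auto
  moreover have "z t = cmat (P t) *v v t \<and>
      w t = cmat (Q t) *v y t - complex_of_real lam *s (cmat (W t) *v y t)"
    if t: "t \<in> {a..b} - ?N" for t
  proof
    have "(y has_vector_derivative v t) (at t)" "(z has_vector_derivative w t) (at t)"
      using t N1 N2 by auto
    moreover obtain v' where "(y has_vector_derivative v') (at t)" "z t = cmat (P t) *v v'"
      using N3 t by blast
    moreover have "(z has_vector_derivative (cmat (Q t) *v y t - complex_of_real lam *s (cmat (W t) *v y t))) (at t)"
      using N4 t by blast
    ultimately show "z t = cmat (P t) *v v t"
      "w t = cmat (Q t) *v y t - complex_of_real lam *s (cmat (W t) *v y t)"
      using vector_derivative_unique_at by blast+
  qed
  ultimately have "sl_integral_solution a b P Q W lam y z v w"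
    unfolding sl_integral_solution_def using v w by blast
  then show "\<exists>v w. sl_integral_solution a b P Q W lam y z v w" by blast
next
  assume "\<exists>v w. sl_integral_solution a b P Q W lam y z v w"
  then obtain v w where sol: "sl_integral_solution a b P Q W lam y z v w" by blast
  obtain N where N: "negligible N"
    "\<And>t. t \<in> {a..b} - N \<Longrightarrow> t \<in> {a<..<b}"
    "\<And>t. t \<in> {a..b} - N \<Longrightarrow> (y has_vector_derivative v t) (at t)"
    "\<And>t. t \<in> {a..b} - N \<Longrightarrow> (z has_vector_derivative w t) (at t)"
    "\<And>t. t \<in> {a..b} - N \<Longrightarrow> z t = cmat (P t) *v v t"
    "\<And>t. t \<in> {a..b} - N \<Longrightarrow>
       w t = cmat (Q t) *v y t - complex_of_real lam *s (cmat (W t) *v y t)"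
    by (rule sl_integral_solution_derivatives[OF sol]) (rule that)
  have "abs_cont_on a b y" "abs_cont_on a b z"
    using sol unfolding sl_integral_solution_def abs_cont_on_def by blast+
  moreover have "AE t in lebesgue_on {a..b}. \<exists>v. (y has_vector_derivative v) (at t) \<and> z t = cmat (P t) *v v"
    unfolding AE_lebesgue_on_iff_negligible using N(1,3,5) by blast
  moreover have "AE t in lebesgue_on {a..b}.
        (z has_vector_derivative (cmat (Q t) *v y t - complex_of_real lam *s (cmat (W t) *v y t))) (at t)"
    unfolding AE_lebesgue_on_iff_negligible
  proof (intro exI conjI ballI)
    show "negligible N" by (rule N)
    fix t assume t: "t \<in> {a..b} - N"
    show "(z has_vector_derivative (cmat (Q t) *v y t - complex_of_real lam *s (cmat (W t) *v y t))) (at t)"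
      using N(4)[OF t] unfolding N(6)[OF t] .
  qed
  ultimately show "sl_solution a b P Q W lam y z" unfolding sl_solution_def by blast
qed

section \<open>Limits of solutions, with a solution and its quasi-derivative as one vector\<close>

lemma has_integral_Pair:
  fixes f :: "'a::euclidean_space \<Rightarrow> 'b::euclidean_space" and g :: "'a \<Rightarrow> 'c::euclidean_space"
  assumes "(f has_integral i) S" "(g has_integral j) S"
  shows "((\<lambda>x. (f x, g x)) has_integral (i, j)) S"
proof -
  have "bounded_linear (\<lambda>u::'b. (u, 0::'c))" "bounded_linear (\<lambda>u::'c. (0::'b, u))"
    by (intro bounded_linear_Pair bounded_linear_ident bounded_linear_zero)+
  from has_integral_add[OF has_integral_linear[OF assms(1) this(1)] has_integral_linear[OF assms(2) this(2)]]
  show ?thesis by (simp add: o_def)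
qed

lemma tendsto_vector_scale:
  fixes x :: "_ \<Rightarrow> complex^'m"
  assumes "(c \<longlongrightarrow> c0) F" "(x \<longlongrightarrow> x0) F"
  shows "((\<lambda>n. c n *s x n) \<longlongrightarrow> c0 *s x0) F"
  by (rule vec_tendstoI) (auto intro!: tendsto_mult assms tendsto_vec_nth)

text \<open>The pair \<open>(y, z)\<close> obeys a linear first-order system, so Gronwall's
  inequality bounds the difference of two solutions by the differences of their initial data and
  parameters; the sequence is uniformly Cauchy. Off one negligible set the densities converge too,
  and dominated convergence carries the integral equations to the limit.\<close>

lemma sl_solutions_uniform_limit:
  fixes P Q W :: "real \<Rightarrow> real^'n^'n" and y z :: "nat \<Rightarrow> real \<Rightarrow> complex^'n"
  assumes ab: "a < b" and Om: "in_Omega a b P Q W"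
    and sol: "\<And>n. sl_solution a b P Q W (lam n) (y n) (z n)"
    and lam: "lam \<longlonglongrightarrow> lam0"
    and init: "(\<lambda>n. (y n a, z n a)) \<longlonglongrightarrow> x0"
  obtains X where "uniform_limit {a..b} (\<lambda>n t. (y n t, z n t)) X sequentially"
    "sl_solution a b P Q W lam0 (\<lambda>t. fst (X t)) (\<lambda>t. snd (X t))"
proof -
  obtain N0 \<mu> C where N0: "negligible N0" and \<mu>: "0 < \<mu>" and C: "0 \<le> C"
    and coer: "\<And>t x. t \<in> {a..b} - N0 \<Longrightarrow> \<mu> * norm x \<le> norm (cmat (P t) *v x)"
    and Qb: "\<And>t x. t \<in> {a..b} - N0 \<Longrightarrow> norm (cmat (Q t) *v x) \<le> C * norm x"
    and Wb: "\<And>t x. t \<in> {a..b} - N0 \<Longrightarrow> norm (cmat (W t) *v x) \<le> C * norm x"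
    by (rule in_Omega_ae[OF Om]) (rule that)
  obtain v w where vw: "\<And>n. sl_integral_solution a b P Q W (lam n) (y n) (z n) (v n) (w n)"
    using sol unfolding sl_solution_iff_integral by metis
  have "\<forall>n. \<exists>N. negligible N \<and> (\<forall>t\<in>{a..b} - N. z n t = cmat (P t) *v v n t \<and>
        w n t = cmat (Q t) *v y n t - complex_of_real (lam n) *s (cmat (W t) *v y n t))"
    using vw unfolding sl_integral_solution_def by blast
  then obtain N' where N': "\<And>n. negligible (N' n)"
    and zP: "\<And>n t. t \<in> {a..b} - N' n \<Longrightarrow> z n t = cmat (P t) *v v n t"
    and wQ: "\<And>n t. t \<in> {a..b} - N' n \<Longrightarrow>
        w n t = cmat (Q t) *v y n t - complex_of_real (lam n) *s (cmat (W t) *v y n t)"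
    by metis
  \<comment> \<open>Countably many exceptional sets are united because the limits below compare all
    indices at the same \<open>t\<close>.\<close>
  define N where "N = N0 \<union> (\<Union>n. N' n)"
  have negN: "negligible N"
    unfolding N_def using N0 N' by (intro negligible_Un negligible_countable_Union) auto
  define x where "x = (\<lambda>n t. (y n t, z n t))"
  define g where "g = (\<lambda>n t. (v n t, w n t))"
  have v_int: "v n integrable_on {a..u}" and w_int: "w n integrable_on {a..u}" if "u \<in> {a..b}" for n u
  proof -
    have "v n integrable_on {a..b}" "w n integrable_on {a..b}"
      using vw[of n] set_lebesgue_integral_eq_integral(1) unfolding sl_integral_solution_def by blast+
    then show "v n integrable_on {a..u}" "w n integrable_on {a..u}"
      using that by (auto intro: integrable_subinterval_real)
  qed
  have g_hi: "(g n has_integral (x n t - x n a)) {a..t}" if t: "t \<in> {a..b}" for n t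
  proof -
    have "y n t = y n a + integral {a..t} (v n)" "z n t = z n a + integral {a..t} (w n)"
      using vw[of n] t unfolding sl_integral_solution_def by blast+
    then have "x n t - x n a = (integral {a..t} (v n), integral {a..t} (w n))"
      by (simp add: x_def)
    then show ?thesis unfolding g_def
      using has_integral_Pair[OF integrable_integral[OF v_int[OF t]] integrable_integral[OF w_int[OF t]]]
      by simp
  qed
  have g_int: "g n integrable_on {a..b}" for n using g_hi[of b n] ab by auto
  have x_eq: "x n t = x n a + integral {a..t} (g n)" if "t \<in> {a..b}" for n t
    using integral_unique[OF g_hi[OF that, of n]] by simp
  obtain \<Lambda> where \<Lambda>: "\<And>n. \<bar>lam n\<bar> \<le> \<Lambda>"
    using convergent_imp_Bseq[OF convergentI[OF lam]] by (auto simp: Bseq_def)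
  have \<Lambda>0: "0 \<le> \<Lambda>" using \<Lambda>[of 0] by simp
  obtain B0 where B0: "\<And>n. norm (x n a) \<le> B0"
    using convergent_imp_Bseq[OF convergentI[OF init]] by (auto simp: Bseq_def x_def)
  \<comment> \<open>Growth constant of the system: \<open>inverse \<mu>\<close> comes from
    \<open>z = P v\<close> by coercivity, \<open>C\<close> from \<open>Q y\<close>, and
    \<open>\<Lambda> * C\<close> from \<open>lam n\<close> times \<open>W y\<close>.\<close>
  define CC where "CC = inverse \<mu> + C + \<Lambda> * C"
  have CC0: "0 \<le> CC" unfolding CC_def using \<mu> C \<Lambda>0 by simp
  have yx: "norm (y n t) \<le> norm (x n t)" and zx: "norm (z n t) \<le> norm (x n t)" for n t
    using norm_fst_le[of "y n t" "z n t"] norm_snd_le[of "z n t" "y n t"] by (simp_all add: x_def)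
  have yxd: "norm (y n t - y m t) \<le> norm (x n t - x m t)"
    and zxd: "norm (z n t - z m t) \<le> norm (x n t - x m t)" for n m t
    using norm_fst_le[of "y n t - y m t" "z n t - z m t"] norm_snd_le[of "z n t - z m t" "y n t - y m t"]
    by (simp_all add: x_def)
  have coer': "norm q \<le> inverse \<mu> * norm (cmat (P t) *v q)" if "t \<in> {a..b} - N" for t q
    using coer[of t q] that \<mu> by (simp add: N_def field_simps)
  have g_le: "norm (g n t) \<le> CC * norm (x n t)" if t: "t \<in> {a..b} - N" for n t
  proof -
    have tn: "t \<in> {a..b} - N' n" "t \<in> {a..b} - N0" using t by (auto simp: N_def)
    have "norm (v n t) \<le> inverse \<mu> * norm (x n t)"
      using coer'[OF t, of "v n t"] zx[of n t] \<mu> unfolding zP[OF tn(1), symmetric]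
      by (meson inverse_nonnegative_iff_nonnegative less_imp_le mult_left_mono order_trans)
    moreover have "norm (w n t) \<le> C * norm (x n t) + \<Lambda> * (C * norm (x n t))"
    proof -
      have "norm (w n t) \<le> norm (cmat (Q t) *v y n t) + \<bar>lam n\<bar> * norm (cmat (W t) *v y n t)"
        unfolding wQ[OF tn(1)] using norm_triangle_ineq4 by (metis norm_of_real norm_vector_scale)
      also have "\<dots> \<le> C * norm (x n t) + \<Lambda> * (C * norm (x n t))"
        using Qb[OF tn(2), of "y n t"] Wb[OF tn(2), of "y n t"] yx[of n t] C \<Lambda>[of n] \<Lambda>0
        by (intro add_mono mult_mono) (auto intro: order_trans mult_left_mono)
      finally show ?thesis .
    qed
    moreover have "norm (g n t) \<le> norm (v n t) + norm (w n t)"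
      unfolding g_def by (rule norm_Pair_le)
    ultimately show ?thesis by (simp add: CC_def algebra_simps)
  qed
  define E where "E = exp (CC * (b - a))"
  have E0: "0 < E" by (simp add: E_def)
  have x_le: "norm (x n t) \<le> B0 * E" if t: "t \<in> {a..b}" for n t
  proof -
    have "norm (x n t) \<le> (norm (x n a) + 0 * (b - a)) * exp (CC * (b - a))"
      by (rule Gronwall_vector[OF _ CC0 _ g_int x_eq negN _ t]) (use ab g_le in auto)
    also have "\<dots> \<le> B0 * E" unfolding E_def by (intro mult_right_mono) (use B0 in auto)
    finally show ?thesis .
  qed
  define B where "B = B0 * E"
  have B: "norm (x n t) \<le> B" if "t \<in> {a..b}" for n t using x_le[OF that] by (simp add: B_def)
  have "norm (x 0 a) \<le> B" by (rule B) (use ab in simp)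
  then have B_0: "0 \<le> B" using norm_ge_zero[of "x 0 a"] by linarith
  have gd_le: "norm (g n t - g m t) \<le> CC * norm (x n t - x m t) + \<bar>lam n - lam m\<bar> * C * B"
    if t: "t \<in> {a..b} - N" for n m t
  proof -
    have tn: "t \<in> {a..b} - N' n" "t \<in> {a..b} - N' m" "t \<in> {a..b} - N0" "t \<in> {a..b}"
      using t by (auto simp: N_def)
    have "cmat (P t) *v (v n t - v m t) = z n t - z m t"
      by (simp add: matrix_vector_mult_diff_distrib zP[OF tn(1)] zP[OF tn(2)])
    then have "norm (v n t - v m t) \<le> inverse \<mu> * norm (z n t - z m t)"
      using coer'[OF t, of "v n t - v m t"] by simp
    also have "\<dots> \<le> inverse \<mu> * norm (x n t - x m t)"
      by (rule mult_left_mono[OF zxd]) (use \<mu> in simp)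
    finally have 1: "norm (v n t - v m t) \<le> inverse \<mu> * norm (x n t - x m t)" .
    \<comment> \<open>The difference of the two terms \<open>lam W y\<close> is split into a part
      linear in \<open>y n - y m\<close> and a part with factor \<open>lam n - lam m\<close>; the
      latter, bounded by means of \<open>B\<close>, is the inhomogeneity for Gronwall.\<close>
    have "w n t - w m t = cmat (Q t) *v (y n t - y m t)
        - complex_of_real (lam n) *s (cmat (W t) *v (y n t - y m t))
        - complex_of_real (lam n - lam m) *s (cmat (W t) *v y m t)"
      unfolding wQ[OF tn(1)] wQ[OF tn(2)] matrix_vector_mult_diff_distrib
      by (simp add: vec_eq_iff algebra_simps)
    then have "norm (w n t - w m t) \<le> norm (cmat (Q t) *v (y n t - y m t))
        + norm (complex_of_real (lam n) *s (cmat (W t) *v (y n t - y m t)))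
        + norm (complex_of_real (lam n - lam m) *s (cmat (W t) *v y m t))"
      using norm_triangle_ineq4[of "cmat (Q t) *v (y n t - y m t)"
          "complex_of_real (lam n) *s (cmat (W t) *v (y n t - y m t))"]
        norm_triangle_ineq4[of "cmat (Q t) *v (y n t - y m t)
          - complex_of_real (lam n) *s (cmat (W t) *v (y n t - y m t))"
          "complex_of_real (lam n - lam m) *s (cmat (W t) *v y m t)"]
      by simp
    also have "\<dots> = norm (cmat (Q t) *v (y n t - y m t))
        + \<bar>lam n\<bar> * norm (cmat (W t) *v (y n t - y m t)) + \<bar>lam n - lam m\<bar> * norm (cmat (W t) *v y m t)"
      by (simp only: norm_vector_scale norm_of_real)
    also have "\<dots> \<le> C * norm (x n t - x m t) + \<Lambda> * (C * norm (x n t - x m t))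
        + \<bar>lam n - lam m\<bar> * (C * B)"
    proof (intro add_mono mult_mono)
      have *: "C * norm (y n t - y m t) \<le> C * norm (x n t - x m t)"
        using yxd C by (rule mult_left_mono)
      show "norm (cmat (Q t) *v (y n t - y m t)) \<le> C * norm (x n t - x m t)"
        "norm (cmat (W t) *v (y n t - y m t)) \<le> C * norm (x n t - x m t)"
        using Qb[OF tn(3)] Wb[OF tn(3)] * order_trans by blast+
      have "norm (y m t) \<le> B" using yx[of m t] B[OF tn(4), of m] by linarith
      then show "norm (cmat (W t) *v y m t) \<le> C * B"
        using Wb[OF tn(3), of "y m t"] mult_left_mono[OF _ C] order_trans by blast
    qed (use \<Lambda> \<Lambda>0 in auto)
    finally have 2: "norm (w n t - w m t) \<le> C * norm (x n t - x m t) + \<Lambda> * (C * norm (x n t - x m t))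
        + \<bar>lam n - lam m\<bar> * (C * B)" .
    have "norm (g n t - g m t) \<le> norm (v n t - v m t) + norm (w n t - w m t)"
      unfolding g_def diff_Pair by (rule norm_Pair_le)
    with 1 2 show ?thesis by (simp add: CC_def algebra_simps)
  qed
  have xd_le: "norm (x n t - x m t) \<le> (norm (x n a - x m a) + \<bar>lam n - lam m\<bar> * C * B * (b - a)) * E"
    if t: "t \<in> {a..b}" for n m t
    unfolding E_def
  proof (rule Gronwall_vector[OF _ CC0 _ _ _ negN _ t, where g = "\<lambda>t. g n t - g m t"])
    show "(\<lambda>t. g n t - g m t) integrable_on {a..b}" by (intro integrable_diff g_int)
    fix u assume u: "u \<in> {a..b}"
    have "x n u - x m u - (x n a - x m a) = integral {a..u} (\<lambda>t. g n t - g m t)"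
      using integral_unique[OF has_integral_diff[OF g_hi[OF u, of n] g_hi[OF u, of m]]]
      by (simp add: algebra_simps)
    then show "x n u - x m u = x n a - x m a + integral {a..u} (\<lambda>t. g n t - g m t)"
      by (simp add: algebra_simps)
  next
    fix u assume "u \<in> {a..b} - N"
    then show "norm (g n u - g m u) \<le> CC * norm (x n u - x m u) + \<bar>lam n - lam m\<bar> * C * B"
      by (rule gd_le)
  qed (use ab C B_0 in auto)
  have "uniformly_Cauchy_on {a..b} x"
  proof (rule uniformly_Cauchy_onI)
    fix e :: real assume e: "0 < e"
    define e' where "e' = e / (2 * E)"
    have e': "0 < e'" using e E0 by (simp add: e'_def)
    \<comment> \<open>The summand 1 keeps \<open>D\<close> positive, so that \<open>e' / D\<close>
      is a legitimate tolerance even if \<open>C * B\<close> vanishes.\<close>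
    define D where "D = C * B * (b - a) + 1"
    have D: "0 < D" unfolding D_def using C B_0 ab by (simp add: add_nonneg_pos)
    have "Cauchy (\<lambda>n. x n a)" using init by (auto simp: x_def intro: LIMSEQ_imp_Cauchy)
    then obtain M1 where M1: "\<And>m n. m \<ge> M1 \<Longrightarrow> n \<ge> M1 \<Longrightarrow> norm (x m a - x n a) < e'"
      using e' unfolding Cauchy_iff by blast
    have "Cauchy lam" using lam by (rule LIMSEQ_imp_Cauchy)
    then obtain M2 where M2: "\<And>m n. m \<ge> M2 \<Longrightarrow> n \<ge> M2 \<Longrightarrow> norm (lam m - lam n) < e' / D"
      using e' D unfolding Cauchy_iff by (meson divide_pos_pos)
    have "dist (x m t) (x n t) < e" if t: "t \<in> {a..b}" and mn: "m \<ge> max M1 M2" "n \<ge> max M1 M2" for t m n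
    proof -
      have "\<bar>lam m - lam n\<bar> * C * B * (b - a) \<le> \<bar>lam m - lam n\<bar> * D"
        unfolding D_def by (simp add: algebra_simps)
      also have "\<dots> < e'" using M2[of m n] mn D by (simp add: pos_less_divide_eq)
      finally have "norm (x m a - x n a) + \<bar>lam m - lam n\<bar> * C * B * (b - a) < e' + e'"
        using M1[of m n] mn by simp
      then have "(norm (x m a - x n a) + \<bar>lam m - lam n\<bar> * C * B * (b - a)) * E < (e' + e') * E"
        using E0 by (rule mult_strict_right_mono)
      also have "(e' + e') * E = e" using E0 by (simp add: e'_def)
      finally show ?thesis using xd_le[OF t, of m n] by (simp add: dist_norm)
    qed
    then show "\<exists>M. \<forall>t\<in>{a..b}. \<forall>m\<ge>M. \<forall>n\<ge>M. dist (x m t) (x n t) < e" by blast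
  qed
  then obtain X where X: "uniform_limit {a..b} x X sequentially"
    using Cauchy_uniformly_convergent uniformly_convergent_on_def by blast
  have Xt: "(\<lambda>n. x n t) \<longlonglongrightarrow> X t" if "t \<in> {a..b}" for t
    by (rule tendsto_uniform_limitI[OF X that])
  have Yt: "(\<lambda>n. y n t) \<longlonglongrightarrow> fst (X t)" and Zt: "(\<lambda>n. z n t) \<longlonglongrightarrow> snd (X t)"
    if "t \<in> {a..b}" for t
    using tendsto_fst[OF Xt[OF that]] tendsto_snd[OF Xt[OF that]] by (simp_all add: x_def)
  \<comment> \<open>\<open>V\<close> is a limit of densities rather than an inverse of
    \<open>P t\<close> applied to the limit of \<open>z\<close>: coercivity makes
    \<open>v n t\<close> Cauchy wherever \<open>z n t\<close> converges, and integrability is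
    inherited by dominated convergence. The value 0 on \<open>N\<close> matches that of
    \<open>g'\<close> below.\<close>
  define V where "V = (\<lambda>t. if t \<in> N then 0 else lim (\<lambda>n. v n t))"
  define U where "U = (\<lambda>t. if t \<in> N then 0 else cmat (Q t) *v fst (X t) - complex_of_real lam0 *s (cmat (W t) *v fst (X t)))"
  have V: "(\<lambda>n. v n t) \<longlonglongrightarrow> V t" if t: "t \<in> {a..b} - N" for t
  proof -
    have "Cauchy (\<lambda>n. v n t)"
      unfolding Cauchy_iff
    proof (intro allI impI)
      fix e :: real assume e: "0 < e"
      have "Cauchy (\<lambda>n. z n t)" using Zt t by (auto intro: LIMSEQ_imp_Cauchy)
      then obtain M where M: "\<And>m n. m \<ge> M \<Longrightarrow> n \<ge> M \<Longrightarrow> norm (z m t - z n t) < \<mu> * e"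
        using e \<mu> unfolding Cauchy_iff by (meson mult_pos_pos)
      have "norm (v m t - v n t) < e" if "m \<ge> M" "n \<ge> M" for m n
      proof -
        have tn: "t \<in> {a..b} - N' n" "t \<in> {a..b} - N' m" "t \<in> {a..b} - N0"
          using t by (auto simp: N_def)
        have "cmat (P t) *v (v m t - v n t) = z m t - z n t"
          by (simp add: matrix_vector_mult_diff_distrib zP[OF tn(1)] zP[OF tn(2)])
        then have "\<mu> * norm (v m t - v n t) \<le> norm (z m t - z n t)"
          using coer[OF tn(3), of "v m t - v n t"] by simp
        also have "\<dots> < \<mu> * e" using M that by blast
        finally show ?thesis using \<mu> by simp
      qed
      then show "\<exists>M. \<forall>m\<ge>M. \<forall>n\<ge>M. norm (v m t - v n t) < e" by blast
    qed
    then have "(\<lambda>n. v n t) \<longlonglongrightarrow> lim (\<lambda>n. v n t)"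
      using Cauchy_convergent_iff convergent_LIMSEQ_iff by blast
    then show ?thesis using t by (simp add: V_def)
  qed
  have U: "(\<lambda>n. w n t) \<longlonglongrightarrow> U t" if t: "t \<in> {a..b} - N" for t
  proof -
    have tab: "t \<in> {a..b}" and tN: "t \<notin> N" using t by auto
    have "(\<lambda>n. cmat (Q t) *v y n t - complex_of_real (lam n) *s (cmat (W t) *v y n t))
        \<longlonglongrightarrow> cmat (Q t) *v fst (X t) - complex_of_real lam0 *s (cmat (W t) *v fst (X t))"
      by (intro tendsto_diff tendsto_vector_scale tendsto_of_real lam Yt[OF tab]
          bounded_linear.tendsto[OF matrix_vector_mul_bounded_linear])
    moreover have "w n t = cmat (Q t) *v y n t - complex_of_real (lam n) *s (cmat (W t) *v y n t)" for n
      by (rule wQ) (use t in \<open>auto simp: N_def\<close>)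
    ultimately show ?thesis using tN by (simp add: U_def)
  qed
  define g' where "g' = (\<lambda>n t. if t \<in> N then 0 else g n t)"
  define G where "G = (\<lambda>t. (V t, U t))"
  have g'_lim: "(\<lambda>n. g' n t) \<longlonglongrightarrow> G t" if "t \<in> {a..b}" for t
    using V[of t] U[of t] that
    by (cases "t \<in> N") (auto simp: g'_def G_def g_def V_def U_def zero_prod_def intro: tendsto_Pair)
  have g'_le: "norm (g' n t) \<le> CC * B" if "t \<in> {a..b}" for n t
  proof (cases "t \<in> N")
    case False
    then have "norm (g n t) \<le> CC * norm (x n t)" using g_le that by auto
    also have "\<dots> \<le> CC * B" by (rule mult_left_mono[OF B[OF that] CC0])
    finally show ?thesis using False by (simp add: g'_def)
  qed (use CC0 B_0 in \<open>simp add: g'_def\<close>)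
  have g'_hi: "(g' n has_integral (x n t - x n a)) {a..t}" if "t \<in> {a..b}" for n t
    by (rule has_integral_spike[OF negN _ g_hi[OF that]]) (simp add: g'_def)
  have G_ai: "G absolutely_integrable_on {a..b}"
  proof (rule dominated_convergence_absolutely_integrable[where f = g' and h = "\<lambda>_. CC * B"])
    show "g' n absolutely_integrable_on {a..b}" for n
      by (rule absolutely_integrable_integrable_bound[where g = "\<lambda>_. CC * B"])
         (use g'_le g'_hi[of b n] ab in \<open>auto simp: integrable_on_def integrable_const_ivl\<close>)
    show "norm (G t) \<le> CC * B" if "t \<in> {a..b}" for t
      by (rule Lim_norm_ubound[OF _ g'_lim[OF that]]) (use g'_le[OF that] in auto)
  qed (use g'_lim in \<open>auto simp: integrable_const_ivl\<close>)
  have G_hi: "(G has_integral (X t - X a)) {a..t}" if t: "t \<in> {a..b}" for t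
  proof (rule has_integral_dominated_convergence[where f = g' and h = "\<lambda>_. CC * B"])
    show "(g' n has_integral (x n t - x n a)) {a..t}" for n by (rule g'_hi[OF t])
    show "(\<lambda>n. x n t - x n a) \<longlonglongrightarrow> X t - X a"
      by (intro tendsto_diff Xt t) (use ab in auto)
  qed (use t g'_le g'_lim in \<open>auto simp: integrable_const_ivl\<close>)
  have "sl_integral_solution a b P Q W lam0 (\<lambda>t. fst (X t)) (\<lambda>t. snd (X t)) V U"
    unfolding sl_integral_solution_def
  proof (intro conjI ballI exI)
    show "V absolutely_integrable_on {a..b}" "U absolutely_integrable_on {a..b}"
      using absolutely_integrable_linear[OF G_ai bounded_linear_fst]
        absolutely_integrable_linear[OF G_ai bounded_linear_snd]
      by (simp_all add: G_def o_def)
    show "fst (X t) = fst (X a) + integral {a..t} V" if "t \<in> {a..b}" for t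
      using integral_unique[OF has_integral_linear[OF G_hi[OF that] bounded_linear_fst]]
      by (simp add: G_def o_def)
    show "snd (X t) = snd (X a) + integral {a..t} U" if "t \<in> {a..b}" for t
      using integral_unique[OF has_integral_linear[OF G_hi[OF that] bounded_linear_snd]]
      by (simp add: G_def o_def)
    show "negligible N" by (rule negN)
    fix t assume t: "t \<in> {a..b} - N"
    have "(\<lambda>n. cmat (P t) *v v n t) \<longlonglongrightarrow> cmat (P t) *v V t"
      by (intro bounded_linear.tendsto[OF matrix_vector_mul_bounded_linear] V t)
    moreover have "cmat (P t) *v v n t = z n t" for n
      by (rule zP[symmetric]) (use t in \<open>auto simp: N_def\<close>)
    ultimately have "(\<lambda>n. z n t) \<longlonglongrightarrow> cmat (P t) *v V t" by simp
    then show "snd (X t) = cmat (P t) *v V t"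
      using LIMSEQ_unique Zt t by blast
    show "U t = cmat (Q t) *v fst (X t) - complex_of_real lam0 *s (cmat (W t) *v fst (X t))"
      using t by (simp add: U_def)
  qed
  then have "sl_solution a b P Q W lam0 (\<lambda>t. fst (X t)) (\<lambda>t. snd (X t))"
    unfolding sl_solution_iff_integral by blast
  with X show thesis using that unfolding x_def by blast
qed

subsection \<open>Lagrange identity and boundary form\<close>

lemma indefinite_integral_Lipschitz:
  fixes f :: "real \<Rightarrow> 'a::euclidean_space"
  assumes g: "g integrable_on {a..b}" and f: "\<And>t. t \<in> {a..b} \<Longrightarrow> f t = f a + integral {a..t} g"
    and N: "negligible N" and le: "\<And>t. t \<in> {a..b} - N \<Longrightarrow> norm (g t) \<le> B" and B: "0 \<le> B"
  shows "B-lipschitz_on {a..b} f"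
proof (rule lipschitz_onI[OF _ B])
  define g' where "g' = (\<lambda>t. if t \<in> N then 0 else g t)"
  have *: "norm (f t - f s) \<le> B * (t - s)" if st: "s \<in> {a..b}" "t \<in> {a..b}" "s \<le> t" for s t
  proof -
    have "integral {a..s} g + integral {s..t} g = integral {a..t} g"
      by (rule Henstock_Kurzweil_Integration.integral_combine)
         (use st in \<open>auto intro: integrable_subinterval_real[OF g]\<close>)
    then have "f t - f s = integral {s..t} g" using f[OF st(1)] f[OF st(2)]
      by (simp add: algebra_simps)
    moreover have "g integrable_on {s..t}"
      using st by (intro integrable_subinterval_real[OF g]) auto
    then have "(g' has_integral integral {s..t} g) {s..t}"
      by (intro has_integral_spike[OF N _ integrable_integral]) (simp add: g'_def)
    then have "norm (integral {s..t} g) \<le> B * measure lborel {s..t}"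
      by (rule has_integral_bound_real[OF B finite.emptyI]) (use st le B in \<open>auto simp: g'_def\<close>)
    ultimately show ?thesis using st by simp
  qed
  fix s t assume "s \<in> {a..b}" "t \<in> {a..b}"
  then show "dist (f s) (f t) \<le> B * dist s t"
    using *[of s t] *[of t s] by (cases "s \<le> t") (auto simp: dist_norm norm_minus_commute)
qed

text \<open>Coercivity bounds \<open>v\<close> by a bound of \<open>z\<close> divided by
  \<open>\<mu>\<close>, and \<open>w\<close> is bounded through \<open>Q\<close> and
  \<open>W\<close>. Products of solutions thus fall under the fundamental theorem for Lipschitz
  functions.\<close>

lemma sl_solution_Lipschitz:
  fixes P Q W :: "real \<Rightarrow> real^'n^'n" and y z :: "real \<Rightarrow> complex^'n"
  assumes ab: "a < b" and Om: "in_Omega a b P Q W" and sol: "sl_solution a b P Q W lam y z"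
  obtains L where "L-lipschitz_on {a..b} y" "L-lipschitz_on {a..b} z"
proof -
  obtain N0 \<mu> C where N0: "negligible N0" and \<mu>: "0 < \<mu>" and C: "0 \<le> C"
    and coer: "\<And>t x. t \<in> {a..b} - N0 \<Longrightarrow> \<mu> * norm x \<le> norm (cmat (P t) *v x)"
    and Qb: "\<And>t x. t \<in> {a..b} - N0 \<Longrightarrow> norm (cmat (Q t) *v x) \<le> C * norm x"
    and Wb: "\<And>t x. t \<in> {a..b} - N0 \<Longrightarrow> norm (cmat (W t) *v x) \<le> C * norm x"
    by (rule in_Omega_ae[OF Om]) (rule that)
  obtain v w where vw: "sl_integral_solution a b P Q W lam y z v w"
    using sol unfolding sl_solution_iff_integral by blast
  obtain N1 where N1: "negligible N1"
    and zP: "\<And>t. t \<in> {a..b} - N1 \<Longrightarrow> z t = cmat (P t) *v v t"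
    and wQ: "\<And>t. t \<in> {a..b} - N1 \<Longrightarrow>
       w t = cmat (Q t) *v y t - complex_of_real lam *s (cmat (W t) *v y t)"
    using vw unfolding sl_integral_solution_def by blast
  have v: "v integrable_on {a..b}" and w: "w integrable_on {a..b}"
    using vw set_lebesgue_integral_eq_integral(1) unfolding sl_integral_solution_def by blast+
  have y_eq: "\<And>t. t \<in> {a..b} \<Longrightarrow> y t = y a + integral {a..t} v"
    and z_eq: "\<And>t. t \<in> {a..b} \<Longrightarrow> z t = z a + integral {a..t} w"
    using vw unfolding sl_integral_solution_def by blast+
  have "continuous_on {a..b} (\<lambda>t. y a + integral {a..t} v)"
    by (intro continuous_intros indefinite_integral_continuous_1 v)
  then have cont_y: "continuous_on {a..b} y" by (rule continuous_on_eq) (rule y_eq[symmetric])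
  have "continuous_on {a..b} (\<lambda>t. z a + integral {a..t} w)"
    by (intro continuous_intros indefinite_integral_continuous_1 w)
  then have cont_z: "continuous_on {a..b} z" by (rule continuous_on_eq) (rule z_eq[symmetric])
  have "bounded (y ` {a..b})" "bounded (z ` {a..b})"
    using cont_y cont_z by (intro compact_imp_bounded compact_continuous_image; simp)+
  then obtain By Bz where By: "\<And>t. t \<in> {a..b} \<Longrightarrow> norm (y t) \<le> By"
    and Bz: "\<And>t. t \<in> {a..b} \<Longrightarrow> norm (z t) \<le> Bz"
    unfolding bounded_iff by blast
  have By0: "0 \<le> By" and Bz0: "0 \<le> Bz"
    using order_trans[OF norm_ge_zero By] order_trans[OF norm_ge_zero Bz] ab
    by (meson atLeastAtMost_iff less_imp_le order_refl)+
  have vB: "norm (v t) \<le> Bz / \<mu>" if t: "t \<in> {a..b} - (N0 \<union> N1)" for t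
  proof -
    have "\<mu> * norm (v t) \<le> norm (z t)" using coer[of t "v t"] zP[of t] t by simp
    also have "\<dots> \<le> Bz" using Bz t by blast
    finally show ?thesis using \<mu> by (simp add: field_simps)
  qed
  have wB: "norm (w t) \<le> C * By + \<bar>lam\<bar> * (C * By)" if t: "t \<in> {a..b} - (N0 \<union> N1)" for t
  proof -
    have t': "t \<in> {a..b} - N0" "t \<in> {a..b} - N1" "t \<in> {a..b}" using t by auto
    have "C * norm (y t) \<le> C * By" by (rule mult_left_mono[OF By[OF t'(3)] C])
    then have 1: "norm (cmat (Q t) *v y t) \<le> C * By" "norm (cmat (W t) *v y t) \<le> C * By"
      using Qb[OF t'(1), of "y t"] Wb[OF t'(1), of "y t"] by linarith+
    have "norm (w t) \<le> norm (cmat (Q t) *v y t) + \<bar>lam\<bar> * norm (cmat (W t) *v y t)"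
      unfolding wQ[OF t'(2)]
      using norm_triangle_ineq4[of "cmat (Q t) *v y t" "complex_of_real lam *s (cmat (W t) *v y t)"]
      by (simp add: norm_vector_scale)
    also have "\<dots> \<le> C * By + \<bar>lam\<bar> * (C * By)"
      by (intro add_mono mult_left_mono 1) auto
    finally show ?thesis .
  qed
  have NN: "negligible (N0 \<union> N1)" using N0 N1 by auto
  have y_lip: "(Bz / \<mu>)-lipschitz_on {a..b} y"
    by (rule indefinite_integral_Lipschitz[OF v y_eq NN vB]) (use \<mu> Bz0 in auto)
  have z_lip: "(C * By + \<bar>lam\<bar> * (C * By))-lipschitz_on {a..b} z"
    by (rule indefinite_integral_Lipschitz[OF w z_eq NN wB]) (use C By0 in auto)
  show thesis
    by (rule that[of "max (Bz / \<mu>) (C * By + \<bar>lam\<bar> * (C * By))"])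
       (auto intro: lipschitz_on_le[OF y_lip] lipschitz_on_le[OF z_lip])
qed

lemma hdot_Lipschitz:
  fixes f g :: "real \<Rightarrow> complex^'m"
  assumes f: "L-lipschitz_on {a..b} f" and g: "M-lipschitz_on {a..b} g"
  obtains R where "R-lipschitz_on {a..b} (\<lambda>t. hdot (f t) (g t))"
proof -
  obtain K where K: "0 \<le> K" "\<And>x y :: complex^'m. norm (hdot x y) \<le> norm x * norm y * K"
    using hdot.nonneg_bounded by blast
  have "bounded (f ` {a..b})" "bounded (g ` {a..b})"
    using lipschitz_on_continuous_on[OF f] lipschitz_on_continuous_on[OF g]
    by (intro compact_imp_bounded compact_continuous_image; simp)+
  then obtain F G where F: "0 < F" "\<And>t. t \<in> {a..b} \<Longrightarrow> norm (f t) \<le> F"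
    and G: "0 < G" "\<And>t. t \<in> {a..b} \<Longrightarrow> norm (g t) \<le> G"
    unfolding bounded_pos by blast
  have L: "0 \<le> L" and M: "0 \<le> M" using f g lipschitz_on_def by blast+
  show thesis
  proof (rule that[OF lipschitz_onI])
    show "0 \<le> (L * G + F * M) * K" using L M F G K by simp
    fix s t assume st: "s \<in> {a..b}" "t \<in> {a..b}"
    have lf: "norm (f s - f t) \<le> L * dist s t" and lg: "norm (g s - g t) \<le> M * dist s t"
      using lipschitz_onD[OF f st] lipschitz_onD[OF g st] by (simp_all add: dist_norm)
    have "hdot (f s) (g s) - hdot (f t) (g t) = hdot (f s - f t) (g s) + hdot (f t) (g s - g t)"
      by (simp add: hdot.diff_left hdot.diff_right)
    then have "norm (hdot (f s) (g s) - hdot (f t) (g t)) \<le> norm (hdot (f s - f t) (g s)) + norm (hdot (f t) (g s - g t))"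
      using norm_triangle_ineq by metis
    also have "\<dots> \<le> (norm (f s - f t) * norm (g s) + norm (f t) * norm (g s - g t)) * K"
      using K(2)[of "f s - f t" "g s"] K(2)[of "f t" "g s - g t"] by (simp add: algebra_simps)
    also have "\<dots> \<le> ((L * dist s t) * G + F * (M * dist s t)) * K"
      using F(1) G(1) L M K(1)
      by (intro mult_right_mono add_mono mult_mono lf lg F(2) G(2) st) auto
    also have "\<dots> = (L * G + F * M) * K * dist s t" by (simp add: algebra_simps)
    finally show "dist (hdot (f s) (g s)) (hdot (f t) (g t)) \<le> (L * G + F * M) * K * dist s t"
      by (simp add: dist_norm)
  qed
qed

text \<open>Primes mark the second solution. In the derivative of \<open>z^* y' - y^* z'\<close> the
  two terms with \<open>P\<close> agree by symmetry, those with \<open>Q\<close> cancel, and those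
  with \<open>W\<close> leave the difference of the parameters, as conjugation fixes the real
  \<open>lam\<close>.\<close>

lemma lagrange_identity:
  fixes P Q W :: "real \<Rightarrow> real^'n^'n" and y z y' z' :: "real \<Rightarrow> complex^'n"
  assumes ab: "a < b" and Om: "in_Omega a b P Q W"
    and sol: "sl_solution a b P Q W lam y z" and sol': "sl_solution a b P Q W lam' y' z'"
  shows "((\<lambda>t. complex_of_real (lam' - lam) * hdot (y t) (cmat (W t) *v y' t)) has_integral
     (hdot (z b) (y' b) - hdot (y b) (z' b)) - (hdot (z a) (y' a) - hdot (y a) (z' a))) {a..b}"
proof -
  obtain N0 where N0: "negligible N0"
    and symP: "\<And>t. t \<in> {a..b} - N0 \<Longrightarrow> transpose (P t) = P t"
    and symQ: "\<And>t. t \<in> {a..b} - N0 \<Longrightarrow> transpose (Q t) = Q t"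
    and symW: "\<And>t. t \<in> {a..b} - N0 \<Longrightarrow> transpose (W t) = W t"
    by (rule in_Omega_ae[OF Om]) (rule that)
  obtain v w where "sl_integral_solution a b P Q W lam y z v w"
    using sol unfolding sl_solution_iff_integral by blast
  then obtain N1 where N1: "negligible N1"
    "\<And>t. t \<in> {a..b} - N1 \<Longrightarrow> t \<in> {a<..<b}"
    "\<And>t. t \<in> {a..b} - N1 \<Longrightarrow> (y has_vector_derivative v t) (at t)"
    "\<And>t. t \<in> {a..b} - N1 \<Longrightarrow> (z has_vector_derivative w t) (at t)"
    "\<And>t. t \<in> {a..b} - N1 \<Longrightarrow> z t = cmat (P t) *v v t"
    "\<And>t. t \<in> {a..b} - N1 \<Longrightarrow>
       w t = cmat (Q t) *v y t - complex_of_real lam *s (cmat (W t) *v y t)"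
    by (rule sl_integral_solution_derivatives) (rule that)
  obtain v' w' where "sl_integral_solution a b P Q W lam' y' z' v' w'"
    using sol' unfolding sl_solution_iff_integral by blast
  then obtain N2 where N2: "negligible N2"
    "\<And>t. t \<in> {a..b} - N2 \<Longrightarrow> t \<in> {a<..<b}"
    "\<And>t. t \<in> {a..b} - N2 \<Longrightarrow> (y' has_vector_derivative v' t) (at t)"
    "\<And>t. t \<in> {a..b} - N2 \<Longrightarrow> (z' has_vector_derivative w' t) (at t)"
    "\<And>t. t \<in> {a..b} - N2 \<Longrightarrow> z' t = cmat (P t) *v v' t"
    "\<And>t. t \<in> {a..b} - N2 \<Longrightarrow>
       w' t = cmat (Q t) *v y' t - complex_of_real lam' *s (cmat (W t) *v y' t)"
    by (rule sl_integral_solution_derivatives) (rule that)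
  obtain L where L: "L-lipschitz_on {a..b} y" "L-lipschitz_on {a..b} z"
    by (rule sl_solution_Lipschitz[OF ab Om sol]) (rule that)
  obtain L' where L': "L'-lipschitz_on {a..b} y'" "L'-lipschitz_on {a..b} z'"
    by (rule sl_solution_Lipschitz[OF ab Om sol']) (rule that)
  obtain R1 where R1: "R1-lipschitz_on {a..b} (\<lambda>t. hdot (z t) (y' t))"
    by (rule hdot_Lipschitz[OF L(2) L'(1)]) (rule that)
  obtain R2 where R2: "R2-lipschitz_on {a..b} (\<lambda>t. hdot (y t) (z' t))"
    by (rule hdot_Lipschitz[OF L(1) L'(2)]) (rule that)
  have lip: "(R1 + R2)-lipschitz_on {a..b} (\<lambda>t. hdot (z t) (y' t) - hdot (y t) (z' t))"
    by (rule lipschitz_on_diff[OF R1 R2])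
  show ?thesis
  proof (rule Lipschitz_fundamental_theorem_of_calculus[OF _ lip, of "N0 \<union> N1 \<union> N2"])
    show "a \<le> b" using ab by simp
    show "negligible (N0 \<union> N1 \<union> N2)" using N0 N1(1) N2(1) by auto
    fix t assume "t \<in> {a<..<b} - (N0 \<union> N1 \<union> N2)"
    then have t: "t \<in> {a..b} - N0" "t \<in> {a..b} - N1" "t \<in> {a..b} - N2" by auto
    have "((\<lambda>t. hdot (z t) (y' t) - hdot (y t) (z' t)) has_vector_derivative
        (hdot (z t) (v' t) + hdot (w t) (y' t)) - (hdot (y t) (w' t) + hdot (v t) (z' t))) (at t)"
      by (intro has_vector_derivative_diff hdot.has_vector_derivative N1(3,4) N2(3,4) t)
    moreover have "hdot (z t) (v' t) = hdot (v t) (z' t)"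
      unfolding N1(5)[OF t(2)] N2(5)[OF t(3)] by (rule hdot_cmat_symmetric[OF symP[OF t(1)]])
    moreover have "hdot (w t) (y' t) - hdot (y t) (w' t)
        = complex_of_real (lam' - lam) * hdot (y t) (cmat (W t) *v y' t)"
      unfolding N1(6)[OF t(2)] N2(6)[OF t(3)]
      by (simp add: hdot.diff_left hdot.diff_right hdot_scale_left hdot_scale_right
          hdot_cmat_symmetric[OF symQ[OF t(1)]] hdot_cmat_symmetric[OF symW[OF t(1)]] algebra_simps)
    ultimately show "((\<lambda>t. hdot (z t) (y' t) - hdot (y t) (z' t)) has_vector_derivative
        complex_of_real (lam' - lam) * hdot (y t) (cmat (W t) *v y' t)) (at t)"
      by (simp add: algebra_simps)
  qed
qed

text \<open>In these coordinates the boundary conditions of \<open>O_K\<close> become the graph \<open>v = - S u\<close>, and the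
  passage from \<open>(rho, eta)\<close> to \<open>(u, v)\<close> preserves the symplectic boundary form.\<close>

definition bd_u :: "real \<Rightarrow> real \<Rightarrow> ('n::finite + 'n) set \<Rightarrow> (real \<Rightarrow> complex^'n)
    \<Rightarrow> (real \<Rightarrow> complex^'n) \<Rightarrow> complex^('n+'n)" where
  "bd_u a b K y z = (\<chi> k. if k \<in> K then bd_eta a b z k else bd_rho a b y k)"

definition bd_v :: "real \<Rightarrow> real \<Rightarrow> ('n::finite + 'n) set \<Rightarrow> (real \<Rightarrow> complex^'n)
    \<Rightarrow> (real \<Rightarrow> complex^'n) \<Rightarrow> complex^('n+'n)" where
  "bd_v a b K y z = (\<chi> k. if k \<in> K then - bd_rho a b y k else bd_eta a b z k)"

text \<open>For \<open>j\<close> in \<open>K\<close> the columns \<open>- e_j\<close> and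
  \<open>s_j\<close> multiply \<open>rho_j\<close> and \<open>eta_j\<close>; otherwise
  \<open>s_j\<close> and \<open>e_j\<close> do. Either way column \<open>j\<close> contributes
  \<open>u_j s_j + v_j e_j\<close>.\<close>

lemma satisfies_bc_iff:
  "satisfies_bc a b K S y z \<longleftrightarrow> S *v bd_u a b K y z + bd_v a b K y z = 0"
proof -
  have "(bcA K S *v (\<chi> k. bd_rho a b y k) + bcB K S *v (\<chi> k. bd_eta a b z k)) $ i
      = (S *v bd_u a b K y z + bd_v a b K y z) $ i" for i
  proof -
    have "(bcA K S *v (\<chi> k. bd_rho a b y k) + bcB K S *v (\<chi> k. bd_eta a b z k)) $ i
      = (\<Sum>j\<in>UNIV. S $ i $ j * bd_u a b K y z $ j + (if j = i then bd_v a b K y z $ i else 0))"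
      unfolding vector_add_component matrix_vector_mult_def vec_lambda_beta sum.distrib[symmetric]
      by (rule sum.cong) (auto simp: bcA_def bcB_def bd_u_def bd_v_def)
    also have "\<dots> = (S *v bd_u a b K y z + bd_v a b K y z) $ i"
      by (simp add: sum.distrib matrix_vector_mult_def)
    finally show ?thesis .
  qed
  then show ?thesis unfolding satisfies_bc_def vec_eq_iff by simp
qed

text \<open>Replacing \<open>(rho, eta)\<close> by \<open>(eta, - rho)\<close> at an index of
  \<open>K\<close> leaves the form unchanged. The sign in \<open>rho = - y a\<close> on the left
  block makes the sum over both blocks the boundary term at \<open>b\<close> minus the one at
  \<open>a\<close>.\<close>

lemma boundary_form:
  "(hdot (z b) (y' b) - hdot (y b) (z' b)) - (hdot (z a) (y' a) - hdot (y a) (z' a))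
    = hdot (bd_v a b K y z) (bd_u a b K y' z') - hdot (bd_u a b K y z) (bd_v a b K y' z')"
proof -
  have "hdot (bd_v a b K y z) (bd_u a b K y' z') - hdot (bd_u a b K y z) (bd_v a b K y' z')
      = (\<Sum>k\<in>UNIV. cnj (bd_eta a b z k) * bd_rho a b y' k - cnj (bd_rho a b y k) * bd_eta a b z' k)"
    unfolding hdot_def sum_subtractf[symmetric]
    by (rule sum.cong) (auto simp: bd_u_def bd_v_def)
  also have "\<dots> = (\<Sum>i\<in>UNIV. cnj (bd_eta a b z (Inl i)) * bd_rho a b y' (Inl i) - cnj (bd_rho a b y (Inl i)) * bd_eta a b z' (Inl i))
     + (\<Sum>i\<in>UNIV. cnj (bd_eta a b z (Inr i)) * bd_rho a b y' (Inr i) - cnj (bd_rho a b y (Inr i)) * bd_eta a b z' (Inr i))"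
    unfolding UNIV_Plus_UNIV[symmetric] by (subst sum.Plus) simp_all
  also have "\<dots> = (hdot (z b) (y' b) - hdot (y b) (z' b)) - (hdot (z a) (y' a) - hdot (y a) (z' a))"
    by (simp add: bd_eta_def bd_rho_def hdot_def sum_subtractf sum_negf sum.distrib)
  finally show ?thesis by simp
qed

text \<open>Both boundary conditions express \<open>v\<close> through \<open>u\<close>; the
  Hermitian \<open>S\<close> moves to the second argument of the form, so that only
  \<open>S' - S\<close> survives. This holds for any two solutions, whatever the distance of
  \<open>S'\<close> from \<open>S\<close>.\<close>

lemma eigenvalue_difference:
  fixes P Q W :: "real \<Rightarrow> real^'n^'n" and y z y' z' :: "real \<Rightarrow> complex^'n"
  assumes ab: "a < b" and Om: "in_Omega a b P Q W" and S: "hermitian S"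
    and sol: "sl_solution a b P Q W lam y z" and bc: "satisfies_bc a b K S y z"
    and sol': "sl_solution a b P Q W lam' y' z'" and bc': "satisfies_bc a b K S' y' z'"
  shows "complex_of_real (lam' - lam) * integral {a..b} (\<lambda>t. hdot (y t) (cmat (W t) *v y' t))
    = hdot (bd_u a b K y z) ((S' - S) *v bd_u a b K y' z')"
proof -
  have v: "bd_v a b K y z = - (S *v bd_u a b K y z)" "bd_v a b K y' z' = - (S' *v bd_u a b K y' z')"
    using bc bc' unfolding satisfies_bc_iff by (simp_all add: eq_neg_iff_add_eq_0 add.commute)
  have "integral {a..b} (\<lambda>t. complex_of_real (lam' - lam) * hdot (y t) (cmat (W t) *v y' t))
      = hdot (bd_v a b K y z) (bd_u a b K y' z') - hdot (bd_u a b K y z) (bd_v a b K y' z')"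
    using integral_unique[OF lagrange_identity[OF ab Om sol sol']] unfolding boundary_form[of _ _ _ _ _ _ K] .
  also have "\<dots> = hdot (bd_u a b K y z) ((S' - S) *v bd_u a b K y' z')"
    unfolding v matrix_vector_mult_diff_rdistrib
    by (simp add: hdot.minus_left hdot.minus_right hdot.diff_right hdot_hermitian[OF S])
  finally show ?thesis by simp
qed

subsection \<open>Simple eigenvalues under perturbation of the boundary condition\<close>

text \<open>\<open>eigenspace_SL\<close> wants functions that vanish off the interval, which limits
  of solutions need not do. The integral form sees only values on \<open>{a..b}\<close>, so such
  changes are harmless.\<close>

lemma sl_solution_cong:
  fixes y z :: "real \<Rightarrow> complex^'n"
  assumes ab: "a \<le> b" and sol: "sl_solution a b P Q W lam y z"
    and eq: "\<And>t. t \<in> {a..b} \<Longrightarrow> y' t = y t" "\<And>t. t \<in> {a..b} \<Longrightarrow> z' t = z t"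
  shows "sl_solution a b P Q W lam y' z'"
proof -
  obtain v w where vw: "sl_integral_solution a b P Q W lam y z v w"
    using sol unfolding sl_solution_iff_integral by blast
  then obtain N where N: "negligible N" "\<And>t. t \<in> {a..b} - N \<Longrightarrow> z t = cmat (P t) *v v t"
    "\<And>t. t \<in> {a..b} - N \<Longrightarrow> w t = cmat (Q t) *v y t - complex_of_real lam *s (cmat (W t) *v y t)"
    unfolding sl_integral_solution_def by blast
  have "a \<in> {a..b}" using ab by simp
  note eqa = eq(1)[OF this] eq(2)[OF this]
  have "sl_integral_solution a b P Q W lam y' z' v w"
    unfolding sl_integral_solution_def
  proof (intro conjI exI ballI)
    show "v absolutely_integrable_on {a..b}" "w absolutely_integrable_on {a..b}"
      using vw unfolding sl_integral_solution_def by blast+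
    show "y' t = y' a + integral {a..t} v" "z' t = z' a + integral {a..t} w" if "t \<in> {a..b}" for t
      unfolding eqa eq(1)[OF that] eq(2)[OF that]
      using vw that unfolding sl_integral_solution_def by blast+
    show "negligible N" by (rule N)
    fix t assume t: "t \<in> {a..b} - N"
    then have "t \<in> {a..b}" by simp
    note eqt = eq(1)[OF this] eq(2)[OF this]
    show "z' t = cmat (P t) *v v t"
      "w t = cmat (Q t) *v y' t - complex_of_real lam *s (cmat (W t) *v y' t)"
      unfolding eqt by (rule N(2,3)[OF t])+
  qed
  then show ?thesis unfolding sl_solution_iff_integral by blast
qed

lemma sl_solution_scaleR:
  fixes y z :: "real \<Rightarrow> complex^'n"
  assumes "sl_solution a b P Q W lam y z"
  shows "sl_solution a b P Q W lam (\<lambda>t. c *\<^sub>R y t) (\<lambda>t. c *\<^sub>R z t)"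
proof -
  obtain v w where vw: "sl_integral_solution a b P Q W lam y z v w"
    using assms unfolding sl_solution_iff_integral by blast
  then obtain N where N: "negligible N" "\<And>t. t \<in> {a..b} - N \<Longrightarrow> z t = cmat (P t) *v v t"
    "\<And>t. t \<in> {a..b} - N \<Longrightarrow> w t = cmat (Q t) *v y t - complex_of_real lam *s (cmat (W t) *v y t)"
    unfolding sl_integral_solution_def by blast
  have lin: "A *v (c *\<^sub>R x) = c *\<^sub>R (A *v x)" for A :: "complex^'n^'n" and x
    by (rule linear_scale[OF bounded_linear.linear[OF matrix_vector_mul_bounded_linear]])
  have comm: "d *s (c *\<^sub>R x) = c *\<^sub>R (d *s x)" for d and x :: "complex^'n"
    by (simp add: vec_eq_iff)
  have "sl_integral_solution a b P Q W lam (\<lambda>t. c *\<^sub>R y t) (\<lambda>t. c *\<^sub>R z t) (\<lambda>t. c *\<^sub>R v t) (\<lambda>t. c *\<^sub>R w t)"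
    unfolding sl_integral_solution_def
  proof (intro conjI exI ballI)
    show "(\<lambda>t. c *\<^sub>R v t) absolutely_integrable_on {a..b}" "(\<lambda>t. c *\<^sub>R w t) absolutely_integrable_on {a..b}"
      using vw unfolding sl_integral_solution_def by (blast intro: absolutely_integrable_scaleR_left)+
    show "c *\<^sub>R y t = c *\<^sub>R y a + integral {a..t} (\<lambda>t. c *\<^sub>R v t)" if t: "t \<in> {a..b}" for t
    proof -
      have "y t = y a + integral {a..t} v"
        using vw t unfolding sl_integral_solution_def by blast
      then show ?thesis by (simp add: scaleR_add_right)
    qed
    show "c *\<^sub>R z t = c *\<^sub>R z a + integral {a..t} (\<lambda>t. c *\<^sub>R w t)" if t: "t \<in> {a..b}" for t
    proof -
      have "z t = z a + integral {a..t} w"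
        using vw t unfolding sl_integral_solution_def by blast
      then show ?thesis by (simp add: scaleR_add_right)
    qed
    show "negligible N" by (rule N)
    fix t assume t: "t \<in> {a..b} - N"
    show "c *\<^sub>R z t = cmat (P t) *v c *\<^sub>R v t"
      unfolding lin N(2)[OF t] ..
    show "c *\<^sub>R w t = cmat (Q t) *v c *\<^sub>R y t - complex_of_real lam *s (cmat (W t) *v c *\<^sub>R y t)"
      unfolding lin comm N(3)[OF t] by (simp add: scaleR_diff_right)
  qed
  then show ?thesis unfolding sl_solution_iff_integral by blast
qed

text \<open>The multiples of a solution with zero initial data have the same initial data, so the
  compactness lemma makes them converge.\<close>

lemma sl_solution_zero_initial:
  fixes P Q W :: "real \<Rightarrow> real^'n^'n" and y z :: "real \<Rightarrow> complex^'n"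
  assumes ab: "a < b" and Om: "in_Omega a b P Q W" and sol: "sl_solution a b P Q W lam y z"
    and init: "y a = 0" "z a = 0" and t: "t \<in> {a..b}"
  shows "y t = 0"
proof (rule ccontr)
  assume y: "y t \<noteq> 0"
  obtain X where X: "uniform_limit {a..b} (\<lambda>n t. (real n *\<^sub>R y t, real n *\<^sub>R z t)) X sequentially"
  proof (rule sl_solutions_uniform_limit[OF ab Om, of "\<lambda>_. lam" "\<lambda>n t. real n *\<^sub>R y t" "\<lambda>n t. real n *\<^sub>R z t" lam])
    show "sl_solution a b P Q W lam (\<lambda>t. real n *\<^sub>R y t) (\<lambda>t. real n *\<^sub>R z t)" for n
      by (rule sl_solution_scaleR[OF sol])
    show "(\<lambda>n. (real n *\<^sub>R y a, real n *\<^sub>R z a)) \<longlonglongrightarrow> (0, 0)"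
      by (simp add: init)
  qed auto
  have "(\<lambda>n. real n *\<^sub>R y t) \<longlonglongrightarrow> fst (X t)"
    using tendsto_fst[OF tendsto_uniform_limitI[OF X t]] by simp
  then have "Bseq (\<lambda>n. real n *\<^sub>R y t)" by (intro convergent_imp_Bseq convergentI)
  then obtain M where M: "\<And>n. norm (real n *\<^sub>R y t) \<le> M" by (auto simp: Bseq_def)
  obtain n :: nat where "real n > M / norm (y t)" using reals_Archimedean2 by blast
  then have "M < norm (real n *\<^sub>R y t)" using y by (simp add: field_simps)
  then show False using M[of n] by simp
qed

lemma satisfies_bc_cong:
  assumes "y' a = y a" "y' b = y b" "z' a = z a" "z' b = z b"
  shows "satisfies_bc a b K S y' z' \<longleftrightarrow> satisfies_bc a b K S y z"
proof -
  have "bd_rho a b y' = bd_rho a b y" "bd_eta a b z' = bd_eta a b z"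
    using assms by (auto simp: bd_rho_def bd_eta_def fun_eq_iff split: sum.split)
  then show ?thesis by (simp add: satisfies_bc_def)
qed

lemma bd_u_scale:
  assumes "y' a = c *s y a" "y' b = c *s y b" "z' a = c *s z a" "z' b = c *s z b"
  shows "bd_u a b K y' z' = c *s bd_u a b K y z"
  using assms by (auto simp: bd_u_def bd_rho_def bd_eta_def vec_eq_iff split: sum.split)

lemma bd_v_scale:
  assumes "y' a = c *s y a" "y' b = c *s y b" "z' a = c *s z a" "z' b = c *s z b"
  shows "bd_v a b K y' z' = c *s bd_v a b K y z"
  using assms by (auto simp: bd_v_def bd_rho_def bd_eta_def vec_eq_iff split: sum.split)

lemma satisfies_bc_scaleR:
  assumes "satisfies_bc a b K S y z"
  shows "satisfies_bc a b K S (\<lambda>t. c *\<^sub>R y t) (\<lambda>t. c *\<^sub>R z t)"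
proof -
  have s: "c *\<^sub>R x = complex_of_real c *s x" for x :: "complex^'c"
    by (simp add: vec_eq_iff scaleR_conv_of_real[where 'a = complex])
  show ?thesis
    using assms unfolding satisfies_bc_iff
    by (simp add: s bd_u_scale[of _ _ "complex_of_real c" y _ _ z] bd_v_scale[of _ _ "complex_of_real c" y _ _ z]
        vector_scalar_commute flip: vector_add_ldistrib)
qed

lemma eigenspace_SL_extend:
  fixes y z :: "real \<Rightarrow> complex^'n"
  assumes ab: "a < b" and sol: "sl_solution a b P Q W lam y z" and bc: "satisfies_bc a b K S y z"
  shows "(\<lambda>t. if t \<in> {a..b} then y t else 0) \<in> eigenspace_SL a b P Q W K S lam"
proof -
  have "sl_solution a b P Q W lam (\<lambda>t. if t \<in> {a..b} then y t else 0) z"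
    by (rule sl_solution_cong[OF _ sol]) (use ab in auto)
  moreover have "satisfies_bc a b K S (\<lambda>t. if t \<in> {a..b} then y t else 0) z"
    by (subst satisfies_bc_cong[of _ _ y _ z z]) (use ab bc in auto)
  ultimately show ?thesis unfolding eigenspace_SL_def by auto
qed

text \<open>Simplicity speaks of \<open>y\<close> alone, while boundary data also involve
  \<open>z\<close>. Uniqueness of derivatives gives \<open>V = c v\<close>, hence
  \<open>Z = c z\<close>, off a negligible set; the densities \<open>U\<close> and
  \<open>c w\<close> agree there as well, so \<open>Z - c z\<close> is constant and therefore zero
  throughout.\<close>

lemma sl_solution_multiple_momentum:
  fixes P Q W :: "real \<Rightarrow> real^'n^'n" and y z Y Z :: "real \<Rightarrow> complex^'n"
  assumes ab: "a < b"
    and sol: "sl_solution a b P Q W lam y z" and sol': "sl_solution a b P Q W lam Y Z"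
    and Y: "\<And>t. t \<in> {a..b} \<Longrightarrow> Y t = c *s y t" and t: "t \<in> {a..b}"
  shows "Z t = c *s z t"
proof -
  have blc: "bounded_linear (\<lambda>x :: complex^'n. c *s x)"
  proof (rule bounded_linear_intro)
    show "norm (c *s x) \<le> norm x * norm c" for x :: "complex^'n"
      by (simp add: norm_vector_scale mult.commute)
  qed (simp_all add: vec_eq_iff algebra_simps)
  obtain v w where vw: "sl_integral_solution a b P Q W lam y z v w"
    using sol unfolding sl_solution_iff_integral by blast
  obtain N1 where N1: "negligible N1"
    "\<And>t. t \<in> {a..b} - N1 \<Longrightarrow> t \<in> {a<..<b}"
    "\<And>t. t \<in> {a..b} - N1 \<Longrightarrow> (y has_vector_derivative v t) (at t)"
    "\<And>t. t \<in> {a..b} - N1 \<Longrightarrow> (z has_vector_derivative w t) (at t)"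
    "\<And>t. t \<in> {a..b} - N1 \<Longrightarrow> z t = cmat (P t) *v v t"
    "\<And>t. t \<in> {a..b} - N1 \<Longrightarrow>
       w t = cmat (Q t) *v y t - complex_of_real lam *s (cmat (W t) *v y t)"
    by (rule sl_integral_solution_derivatives[OF vw]) (rule that)
  obtain V U where VU: "sl_integral_solution a b P Q W lam Y Z V U"
    using sol' unfolding sl_solution_iff_integral by blast
  obtain N2 where N2: "negligible N2"
    "\<And>t. t \<in> {a..b} - N2 \<Longrightarrow> t \<in> {a<..<b}"
    "\<And>t. t \<in> {a..b} - N2 \<Longrightarrow> (Y has_vector_derivative V t) (at t)"
    "\<And>t. t \<in> {a..b} - N2 \<Longrightarrow> (Z has_vector_derivative U t) (at t)"
    "\<And>t. t \<in> {a..b} - N2 \<Longrightarrow> Z t = cmat (P t) *v V t"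
    "\<And>t. t \<in> {a..b} - N2 \<Longrightarrow>
       U t = cmat (Q t) *v Y t - complex_of_real lam *s (cmat (W t) *v Y t)"
    by (rule sl_integral_solution_derivatives[OF VU]) (rule that)
  define N where "N = N1 \<union> N2"
  have N: "negligible N" unfolding N_def using N1(1) N2(1) by auto
  have off: "Z t = c *s z t" if t: "t \<in> {a..b} - N" for t
  proof -
    have t1: "t \<in> {a..b} - N1" and t2: "t \<in> {a..b} - N2" using t by (auto simp: N_def)
    have "((\<lambda>t. c *s y t) has_vector_derivative c *s v t) (at t)"
      by (rule bounded_linear.has_vector_derivative[OF blc N1(3)[OF t1]])
    then have "(Y has_vector_derivative c *s v t) (at t)"
      by (rule has_vector_derivative_transform_within_open[of _ _ _ "{a<..<b}"])
         (use N1(2)[OF t1] Y in auto)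
    then have "V t = c *s v t" using N2(3)[OF t2] vector_derivative_unique_at by blast
    then show ?thesis
      unfolding N2(5)[OF t2] N1(5)[OF t1] by (simp add: vector_scalar_commute)
  qed
  have w: "w integrable_on {a..b}"
    using vw set_lebesgue_integral_eq_integral(1) unfolding sl_integral_solution_def by blast
  have diff: "Z t - c *s z t = Z a - c *s z a" if t: "t \<in> {a..b}" for t
  proof -
    have "w integrable_on {a..t}"
      by (rule integrable_subinterval_real[OF w]) (use t in auto)
    then have "((\<lambda>s. c *s w s) has_integral c *s integral {a..t} w) {a..t}"
      using has_integral_linear[OF integrable_integral blc, of w "{a..t}"] by (simp add: o_def)
    then have "(U has_integral c *s integral {a..t} w) {a..t}"
    proof (rule has_integral_spike[OF N, rotated])
      fix s assume "s \<in> {a..t} - N"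
      then have s: "s \<in> {a..b} - N1" "s \<in> {a..b} - N2" "s \<in> {a..b}" using t by (auto simp: N_def)
      show "U s = c *s w s"
        unfolding N2(6)[OF s(2)] N1(6)[OF s(1)] Y[OF s(3)]
        by (simp add: vec_eq_iff algebra_simps vector_scalar_commute)
    qed
    then have "integral {a..t} U = c *s integral {a..t} w" by (rule integral_unique)
    moreover have "Z t = Z a + integral {a..t} U" "z t = z a + integral {a..t} w"
      using vw VU t unfolding sl_integral_solution_def by blast+
    ultimately show ?thesis by (simp add: vec_eq_iff algebra_simps)
  qed
  \<comment> \<open>An interval of positive length has a point outside \<open>N\<close>, and there
    the constant is seen to vanish.\<close>
  have "\<not> negligible {a..b}" using ab negligible_interval(1)[of a b] by simp
  then obtain s where s: "s \<in> {a..b} - N" using N negligible_subset by blast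
  then have "Z s - c *s z s = 0" using off by simp
  then have "Z t - c *s z t = 0" using diff[of s] diff[OF t] s by simp
  then show ?thesis by simp
qed

text \<open>The generator \<open>y0\<close> in the definition of simplicity need not be
  \<open>y\<close>; since \<open>y\<close> is nonzero, its coefficient \<open>c1\<close> is
  invertible and \<open>y\<close> can replace \<open>y0\<close>.\<close>

lemma simple_eigenvalue_multiple:
  fixes P Q W :: "real \<Rightarrow> real^'n^'n" and y z Y Z :: "real \<Rightarrow> complex^'n"
  assumes ab: "a < b" and simple: "simple_eigenvalue_SL a b P Q W K S lam"
    and sol: "sl_solution a b P Q W lam y z" and bc: "satisfies_bc a b K S y z"
    and nz: "\<exists>t\<in>{a..b}. y t \<noteq> 0"
    and sol': "sl_solution a b P Q W lam Y Z" and bc': "satisfies_bc a b K S Y Z"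
  obtains c where "\<And>t. t \<in> {a..b} \<Longrightarrow> Y t = c *s y t" "\<And>t. t \<in> {a..b} \<Longrightarrow> Z t = c *s z t"
proof -
  obtain y0 where y0: "\<And>y. y \<in> eigenspace_SL a b P Q W K S lam \<Longrightarrow> \<exists>c::complex. \<forall>t. y t = c *s y0 t"
    using simple unfolding simple_eigenvalue_SL_def by blast
  obtain c1 where "\<And>t. (if t \<in> {a..b} then y t else 0) = c1 *s y0 t"
    using y0[OF eigenspace_SL_extend[OF ab sol bc]] by blast
  then have c1: "y t = c1 *s y0 t" if "t \<in> {a..b}" for t using that by (metis (full_types))
  obtain c2 where "\<And>t. (if t \<in> {a..b} then Y t else 0) = c2 *s y0 t"
    using y0[OF eigenspace_SL_extend[OF ab sol' bc']] by blast
  then have c2: "Y t = c2 *s y0 t" if "t \<in> {a..b}" for t using that by (metis (full_types))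
  have "c1 \<noteq> 0" using nz c1 by auto
  then have Y: "Y t = (c2 / c1) *s y t" if "t \<in> {a..b}" for t
    using c1[OF that] c2[OF that] by (simp add: vec_eq_iff)
  show thesis
    by (rule that[OF Y sl_solution_multiple_momentum[OF ab sol sol' Y]])
qed

section \<open>Integrability and continuity of the weighted pairing\<close>

text \<open>\<open>W\<close> is merely measurable and essentially bounded. Each entry times a
  continuous function is a bounded measurable function on a space of finite measure, hence
  integrable.\<close>

lemma weighted_hdot_integrable:
  fixes P Q W :: "real \<Rightarrow> real^'n^'n" and f g :: "real \<Rightarrow> complex^'n"
  assumes Om: "in_Omega a b P Q W" and f: "continuous_on {a..b} f" and g: "continuous_on {a..b} g"
  shows "(\<lambda>t. hdot (f t) (cmat (W t) *v g t)) integrable_on {a..b}"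
proof -
  have "(\<lambda>t. cnj (f t $ i) * (complex_of_real (W t $ i $ j) * g t $ j)) integrable_on {a..b}" for i j
  proof -
    have W: "(\<lambda>t. W t $ i $ j) \<in> borel_measurable (lebesgue_on {a..b})"
      "\<exists>C. AE t in lebesgue_on {a..b}. \<bar>W t $ i $ j\<bar> \<le> C"
      using Om unfolding in_Omega_def sym_Linf_def Linf_on_def by blast+
    then obtain C where C: "AE t in lebesgue_on {a..b}. \<bar>W t $ i $ j\<bar> \<le> C" by blast
    define h where "h = (\<lambda>t. cnj (f t $ i) * g t $ j)"
    have h: "continuous_on {a..b} h" unfolding h_def by (intro continuous_intros f g)
    then have "bounded (h ` {a..b})" by (intro compact_imp_bounded compact_continuous_image) auto
    then obtain H where H: "0 < H" "\<And>t. t \<in> {a..b} \<Longrightarrow> norm (h t) \<le> H" unfolding bounded_pos by blast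
    have "integrable (lebesgue_on {a..b}) (\<lambda>t. (W t $ i $ j) *\<^sub>R h t)"
    proof (rule finite_measure.integrable_const_bound)
      show "finite_measure (lebesgue_on {a..b})" by (rule finite_measure_lebesgue_on) simp
      have "AE t in lebesgue_on {a..b}. t \<in> {a..b}" by (rule AE_I2) simp
      with C show "AE t in lebesgue_on {a..b}. norm ((W t $ i $ j) *\<^sub>R h t) \<le> C * H"
      proof eventually_elim
        case (elim t)
        then show ?case unfolding norm_scaleR using H(2)[of t] by (intro mult_mono) auto
      qed
      have "h \<in> borel_measurable (lebesgue_on {a..b})"
        by (rule continuous_imp_measurable_on_sets_lebesgue[OF h]) simp
      then show "(\<lambda>t. (W t $ i $ j) *\<^sub>R h t) \<in> borel_measurable (lebesgue_on {a..b})"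
        using W(1) by (intro borel_measurable_scaleR)
    qed
    then have "(\<lambda>t. (W t $ i $ j) *\<^sub>R h t) integrable_on {a..b}"
      by (rule integrable_on_lebesgue_on) simp
    then show ?thesis by (simp add: h_def scaleR_conv_of_real[where 'a = complex] ac_simps)
  qed
  then show ?thesis
    unfolding hdot_def cmat_def matrix_vector_mult_def vec_lambda_beta sum_distrib_left
    by (intro integrable_sum) auto
qed

lemma weighted_hdot_integral_tendsto:
  fixes P Q W :: "real \<Rightarrow> real^'n^'n" and f G :: "real \<Rightarrow> complex^'n"
  assumes ab: "a < b" and Om: "in_Omega a b P Q W" and f: "continuous_on {a..b} f"
    and g: "\<And>n. continuous_on {a..b} (g n)" and lim: "uniform_limit {a..b} g G sequentially"
  shows "(\<lambda>n. integral {a..b} (\<lambda>t. hdot (f t) (cmat (W t) *v g n t)))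
    \<longlonglongrightarrow> integral {a..b} (\<lambda>t. hdot (f t) (cmat (W t) *v G t))"
proof (rule tendstoI)
  fix e :: real assume e: "0 < e"
  obtain N \<mu> C where N: "negligible N" and "0 < \<mu>" and C: "0 \<le> C" and
    "\<And>t x. t \<in> {a..b} - N \<Longrightarrow> \<mu> * norm x \<le> norm (cmat (P t) *v x)"
    and Wb: "\<And>t x. t \<in> {a..b} - N \<Longrightarrow> norm (cmat (W t) *v x) \<le> C * norm x"
    by (rule in_Omega_ae[OF Om]) (rule that)
  obtain K where K: "0 \<le> K" "\<And>x y :: complex^'n. norm (hdot x y) \<le> norm x * norm y * K"
    using hdot.nonneg_bounded by blast
  have "bounded (f ` {a..b})" using f by (intro compact_imp_bounded compact_continuous_image) auto
  then obtain F where F: "0 < F" "\<And>t. t \<in> {a..b} \<Longrightarrow> norm (f t) \<le> F" unfolding bounded_pos by blast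
  have G: "continuous_on {a..b} G"
    by (rule uniform_limit_theorem[OF _ lim]) (use g in auto)
  define R where "R = F * C * K"
  have R: "0 \<le> R" unfolding R_def using F C K by simp
  \<comment> \<open>The summand 1 excludes division by zero and leaves room for the strict
    inequality \<open>R * (b - a) * d < e\<close>.\<close>
  define d where "d = e / (R * (b - a) + 1)"
  have Rab: "0 \<le> R * (b - a)" using R ab by simp
  then have d: "0 < d" unfolding d_def using e by simp
  have "\<forall>\<^sub>F n in sequentially. \<forall>t\<in>{a..b}. dist (g n t) (G t) < d"
    using lim d unfolding uniform_limit_iff by blast
  then show "\<forall>\<^sub>F n in sequentially. dist (integral {a..b} (\<lambda>t. hdot (f t) (cmat (W t) *v g n t)))
      (integral {a..b} (\<lambda>t. hdot (f t) (cmat (W t) *v G t))) < e"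
  proof eventually_elim
    case (elim n)
    define h where "h = (\<lambda>t. hdot (f t) (cmat (W t) *v (g n t - G t)))"
    have h: "h integrable_on {a..b}"
      unfolding h_def by (intro weighted_hdot_integrable[OF Om f] continuous_intros g G)
    \<comment> \<open>The Lipschitz estimate for indefinite integrals acts here as a norm bound for
      \<open>integral {a..b} h\<close> from a bound that holds off a negligible set.\<close>
    have "(R * d)-lipschitz_on {a..b} (\<lambda>t. integral {a..t} h)"
    proof (rule indefinite_integral_Lipschitz[OF h _ N])
      fix t assume t: "t \<in> {a..b} - N"
      then have tab: "t \<in> {a..b}" by simp
      have gd: "norm (g n t - G t) \<le> d" using elim tab by (auto simp: dist_norm less_imp_le)
      have "norm (cmat (W t) *v (g n t - G t)) \<le> C * d"
        using Wb[OF t, of "g n t - G t"] mult_left_mono[OF gd C] by linarith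
      then have "norm (h t) \<le> F * (C * d) * K"
        unfolding h_def using F K(1) F(2)[OF tab]
        by (intro order_trans[OF K(2)] mult_right_mono mult_mono) auto
      then show "norm (h t) \<le> R * d" by (simp add: R_def ac_simps)
    qed (use R d in auto)
    then have "dist (integral {a..b} h) (integral {a..a} h) \<le> R * d * dist b a"
      by (rule lipschitz_onD) (use ab in auto)
    then have "norm (integral {a..b} h) \<le> R * (b - a) * d"
      using ab by (simp add: dist_norm ac_simps)
    also have "\<dots> < (R * (b - a) + 1) * d" using d by simp
    also have "\<dots> = e" unfolding d_def using Rab by simp
    finally have "norm (integral {a..b} h) < e" .
    moreover have "integral {a..b} h = integral {a..b} (\<lambda>t. hdot (f t) (cmat (W t) *v g n t))
        - integral {a..b} (\<lambda>t. hdot (f t) (cmat (W t) *v G t))"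
      unfolding h_def matrix_vector_mult_diff_distrib hdot.diff_right
      by (intro integral_diff weighted_hdot_integrable[OF Om f] g G)
    ultimately show ?case by (simp add: dist_norm)
  qed
qed

section \<open>The difference quotient along sequences of boundary conditions\<close>

text \<open>The direction of \<open>S n - S0\<close> may vary with \<open>n\<close>; the error is
  bounded by the norm of this matrix times a null sequence, so a full derivative results rather than
  directional ones. The subsequence stems from compactness of the unit sphere of initial
  data.\<close>

lemma eigenvalue_quotient_subsequence:
  fixes P Q W :: "real \<Rightarrow> real^'n^'n" and y z :: "real \<Rightarrow> complex^'n"
    and S :: "nat \<Rightarrow> complex^('n+'n)^('n+'n)"
  assumes ab: "a < b" and Om: "in_Omega a b P Q W" and S0: "hermitian S0"
    and simple: "simple_eigenvalue_SL a b P Q W K S0 lam0"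
    and sol: "sl_solution a b P Q W lam0 y z" and bc: "satisfies_bc a b K S0 y z"
    and normal: "integral {a..b} (\<lambda>t. hdot (y t) (cmat (W t) *v y t)) = 1"
    and S: "S \<longlonglongrightarrow> S0" and lam: "lam \<longlonglongrightarrow> lam0"
    and eig: "\<And>n. is_eigenvalue_SL a b P Q W K (S n) (lam n)"
  obtains r where "strict_mono r"
    "(\<lambda>n. (complex_of_real (lam (r n) - lam0) - hdot (bd_u a b K y z) ((S (r n) - S0) *v bd_u a b K y z))
        /\<^sub>R norm (S (r n) - S0)) \<longlonglongrightarrow> 0"
proof -
  have ainab: "a \<in> {a..b}" and binab: "b \<in> {a..b}" using ab by auto
  have "\<exists>yn zn. sl_solution a b P Q W (lam n) yn zn \<and> satisfies_bc a b K (S n) yn zn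
      \<and> norm (yn a, zn a) = 1" for n
  proof -
    obtain y1 z1 where 1: "sl_solution a b P Q W (lam n) y1 z1" "satisfies_bc a b K (S n) y1 z1"
      "\<exists>t\<in>{a..b}. y1 t \<noteq> 0"
      using eig[of n] unfolding is_eigenvalue_SL_def eigenspace_SL_def by blast
    \<comment> \<open>A nontrivial solution has nonzero initial data, so these can be scaled to norm
      1.\<close>
    then have nz: "(y1 a, z1 a) \<noteq> 0"
      using sl_solution_zero_initial[OF ab Om 1(1)] by (auto simp: zero_prod_def)
    let ?c = "inverse (norm (y1 a, z1 a))"
    have "norm (?c *\<^sub>R y1 a, ?c *\<^sub>R z1 a) = norm (?c *\<^sub>R (y1 a, z1 a))" by simp
    also have "\<dots> = 1" using nz by (simp only: norm_scaleR) simp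
    finally show ?thesis
      using sl_solution_scaleR[OF 1(1), of ?c] satisfies_bc_scaleR[OF 1(2), of ?c] by blast
  qed
  then obtain yn zn where sol_n: "\<And>n. sl_solution a b P Q W (lam n) (yn n) (zn n)"
    and bc_n: "\<And>n. satisfies_bc a b K (S n) (yn n) (zn n)"
    and norm_n: "\<And>n. norm (yn n a, zn n a) = 1" by metis
  have "seq_compact (sphere (0 :: (complex^'n) \<times> (complex^'n)) 1)"
    by (intro compact_imp_seq_compact compact_sphere)
  moreover have "\<forall>n. (yn n a, zn n a) \<in> sphere 0 1" using norm_n by simp
  ultimately obtain x0 r where r: "strict_mono (r :: nat \<Rightarrow> nat)" and "x0 \<in> sphere 0 1"
    and "((\<lambda>n. (yn n a, zn n a)) \<circ> r) \<longlonglongrightarrow> x0" by (rule seq_compactE)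
  then have init: "(\<lambda>n. (yn (r n) a, zn (r n) a)) \<longlonglongrightarrow> x0" and x0: "norm x0 = 1"
    by (simp_all add: o_def)
  have lam_r: "(\<lambda>n. lam (r n)) \<longlonglongrightarrow> lam0" and S_r: "(\<lambda>n. S (r n)) \<longlonglongrightarrow> S0"
    using LIMSEQ_subseq_LIMSEQ[OF lam r] LIMSEQ_subseq_LIMSEQ[OF S r] by (simp_all add: o_def)
  obtain X where X: "uniform_limit {a..b} (\<lambda>n t. (yn (r n) t, zn (r n) t)) X sequentially"
    and solX: "sl_solution a b P Q W lam0 (\<lambda>t. fst (X t)) (\<lambda>t. snd (X t))"
    by (rule sl_solutions_uniform_limit[OF ab Om sol_n lam_r init]) (rule that)
  have Y_t: "(\<lambda>n. yn (r n) t) \<longlonglongrightarrow> fst (X t)" and Z_t: "(\<lambda>n. zn (r n) t) \<longlonglongrightarrow> snd (X t)"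
    if "t \<in> {a..b}" for t
    using tendsto_fst[OF tendsto_uniform_limitI[OF X that]] tendsto_snd[OF tendsto_uniform_limitI[OF X that]]
    by simp_all
  define u where "u = bd_u a b K y z"
  define un where "un = (\<lambda>n. bd_u a b K (yn (r n)) (zn (r n)))"
  let ?uX = "bd_u a b K (\<lambda>t. fst (X t)) (\<lambda>t. snd (X t))"
  have un: "un \<longlonglongrightarrow> ?uX"
  proof (rule vec_tendstoI)
    fix k show "(\<lambda>n. un n $ k) \<longlonglongrightarrow> ?uX $ k"
      unfolding un_def bd_u_def vec_lambda_beta bd_eta_def bd_rho_def
      by (cases k; cases "k \<in> K"; simp)
         (intro tendsto_intros tendsto_vec_nth Y_t Z_t ainab binab)+
  qed
  have vn: "(\<lambda>n. bd_v a b K (yn (r n)) (zn (r n))) \<longlonglongrightarrow> bd_v a b K (\<lambda>t. fst (X t)) (\<lambda>t. snd (X t))"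
  proof (rule vec_tendstoI)
    fix k show "(\<lambda>n. bd_v a b K (yn (r n)) (zn (r n)) $ k) \<longlonglongrightarrow> bd_v a b K (\<lambda>t. fst (X t)) (\<lambda>t. snd (X t)) $ k"
      unfolding bd_v_def vec_lambda_beta bd_eta_def bd_rho_def
      by (cases k; cases "k \<in> K"; simp)
         (intro tendsto_intros tendsto_vec_nth Y_t Z_t ainab binab)+
  qed
  have "(\<lambda>n. S (r n) *v un n) \<longlonglongrightarrow> S0 *v ?uX"
  proof (rule vec_tendstoI)
    fix i show "(\<lambda>n. (S (r n) *v un n) $ i) \<longlonglongrightarrow> (S0 *v ?uX) $ i"
      unfolding matrix_vector_mult_def vec_lambda_beta
      by (intro tendsto_sum tendsto_mult tendsto_vec_nth S_r un)
  qed
  \<comment> \<open>The boundary condition is closed: the sum is 0 for every \<open>n\<close>, hence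
    its limit is 0.\<close>
  from tendsto_add[OF this vn]
  have "(\<lambda>n. 0) \<longlonglongrightarrow> S0 *v ?uX + bd_v a b K (\<lambda>t. fst (X t)) (\<lambda>t. snd (X t))"
    using bc_n unfolding satisfies_bc_iff un_def by simp
  from LIMSEQ_unique[OF tendsto_const this]
  have bcX: "satisfies_bc a b K S0 (\<lambda>t. fst (X t)) (\<lambda>t. snd (X t))"
    unfolding satisfies_bc_iff by (rule sym)
  have "\<exists>t\<in>{a..b}. y t \<noteq> 0"
  proof (rule ccontr)
    assume "\<not> ?thesis"
    then have "integral {a..b} (\<lambda>t. hdot (y t) (cmat (W t) *v y t)) = integral {a..b} (\<lambda>t. 0)"
      by (intro integral_cong) (simp add: hdot.zero_left)
    then show False using normal by simp
  qed
  then obtain c where Yc: "\<And>t. t \<in> {a..b} \<Longrightarrow> fst (X t) = c *s y t"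
    and Zc: "\<And>t. t \<in> {a..b} \<Longrightarrow> snd (X t) = c *s z t"
    by (rule simple_eigenvalue_multiple[OF ab simple sol bc _ solX bcX]) (rule that)
  have "X a = x0"
    using LIMSEQ_unique[OF tendsto_uniform_limitI[OF X ainab] init] .
  \<comment> \<open>The norm 1 of the initial data survives the limit, so \<open>X\<close> is not
    the zero solution.\<close>
  then have c0: "c \<noteq> 0"
    using x0 Yc[OF ainab] Zc[OF ainab] by (auto simp: prod_eq_iff norm_prod_def)
  have uX: "?uX = c *s u"
    unfolding u_def by (rule bd_u_scale) (use Yc Zc ainab binab in auto)
  obtain L where L: "L-lipschitz_on {a..b} y" "L-lipschitz_on {a..b} z"
    by (rule sl_solution_Lipschitz[OF ab Om sol]) (rule that)
  have cont_y: "continuous_on {a..b} y" using lipschitz_on_continuous_on[OF L(1)] .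
  have cont_yn: "continuous_on {a..b} (yn n)" for n
  proof -
    obtain M where "M-lipschitz_on {a..b} (yn n)"
      by (rule sl_solution_Lipschitz[OF ab Om sol_n[of n]]) (rule that)
    then show ?thesis by (rule lipschitz_on_continuous_on)
  qed
  define I where "I = (\<lambda>n. integral {a..b} (\<lambda>t. hdot (y t) (cmat (W t) *v yn (r n) t)))"
  have "uniform_limit {a..b} (\<lambda>n. yn (r n)) (\<lambda>t. fst (X t)) sequentially"
    using bounded_linear.uniform_limit[OF bounded_linear_fst X] by simp
  from weighted_hdot_integral_tendsto[OF ab Om cont_y cont_yn this]
  have "I \<longlonglongrightarrow> integral {a..b} (\<lambda>t. hdot (y t) (cmat (W t) *v fst (X t)))" unfolding I_def .
  also have "integral {a..b} (\<lambda>t. hdot (y t) (cmat (W t) *v fst (X t)))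
      = integral {a..b} (\<lambda>t. c * hdot (y t) (cmat (W t) *v y t))"
    by (rule integral_cong) (simp add: Yc vector_scalar_commute hdot_scale_right)
  also have "\<dots> = c" using normal by simp
  finally have I: "I \<longlonglongrightarrow> c" .
  \<comment> \<open>Both \<open>un n\<close> and \<open>I n\<close> scale with the chosen
    eigenfunction. The normalization of \<open>y\<close> makes \<open>c\<close> the limit of
    \<open>I\<close>, so the unknown factor cancels and \<open>q\<close> tends to \<open>u\<close>
    itself.\<close>
  define q where "q = (\<lambda>n. inverse (I n) *s un n)"
  have "q \<longlonglongrightarrow> inverse c *s (c *s u)"
    unfolding q_def using un[unfolded uX] tendsto_inverse[OF I c0] by (intro tendsto_vector_scale)
  then have q: "q \<longlonglongrightarrow> u" using c0 by simp
  obtain M where M: "0 \<le> M" "\<And>x y :: complex^('n+'n). norm (hdot x y) \<le> norm x * norm y * M"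
    using hdot.nonneg_bounded by blast
  let ?H = "\<lambda>n. S (r n) - S0"
  let ?m = "real CARD('n + 'n) * real CARD('n + 'n)"
  let ?d = "\<lambda>n. (complex_of_real (lam (r n) - lam0) - hdot u (?H n *v u)) /\<^sub>R norm (?H n)"
  have "\<forall>\<^sub>F n in sequentially. I n \<noteq> 0"
    using I c0 tendsto_imp_eventually_ne by blast
  then have d_le: "\<forall>\<^sub>F n in sequentially. norm (?d n) \<le> norm u * (?m * norm (q n - u)) * M"
  proof eventually_elim
    case (elim n)
    have "complex_of_real (lam (r n) - lam0) * I n = hdot u (?H n *v un n)"
      unfolding I_def u_def un_def
      by (rule eigenvalue_difference[OF ab Om S0 sol bc sol_n bc_n])
    then have "complex_of_real (lam (r n) - lam0) = hdot u (?H n *v q n)"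
      using elim unfolding q_def by (simp add: vector_scalar_commute hdot_scale_right field_simps)
    then have "complex_of_real (lam (r n) - lam0) - hdot u (?H n *v u) = hdot u (?H n *v (q n - u))"
      by (simp add: matrix_vector_mult_diff_distrib hdot.diff_right)
    then have "norm (complex_of_real (lam (r n) - lam0) - hdot u (?H n *v u))
        \<le> norm u * norm (?H n *v (q n - u)) * M" using M(2) by simp
    also have "\<dots> \<le> norm u * (?m * norm (?H n) * norm (q n - u)) * M"
      by (intro mult_right_mono mult_left_mono norm_matrix_vector_mult_le M) auto
    also have "\<dots> = norm (?H n) * (norm u * (?m * norm (q n - u)) * M)" by (simp add: ac_simps)
    finally have *: "norm (complex_of_real (lam (r n) - lam0) - hdot u (?H n *v u))
        \<le> norm (?H n) * (norm u * (?m * norm (q n - u)) * M)" .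
    show ?case
    \<comment> \<open>\<open>S (r n) = S0\<close> is possible here; the quotient is then 0, because
      \<open>inverse 0 = 0\<close>.\<close>
    proof (cases "norm (?H n) = 0")
      case True
      then show ?thesis using M(1) by simp
    next
      case False
      then have "inverse (norm (?H n)) * norm (complex_of_real (lam (r n) - lam0) - hdot u (?H n *v u))
          \<le> norm u * (?m * norm (q n - u)) * M"
        using * by (simp add: divide_inverse[symmetric] mult.commute[of "inverse _"] pos_divide_le_eq mult.commute[of "norm (?H n)"])
      then show ?thesis by (simp only: norm_scaleR) simp
    qed
  qed
  have "(\<lambda>n. norm u * (?m * norm (q n - u)) * M) \<longlonglongrightarrow> norm u * (?m * 0) * M"
    by (intro tendsto_mult tendsto_const tendsto_norm_zero LIM_zero q)
  then have "(\<lambda>n. norm u * (?m * norm (q n - u)) * M) \<longlonglongrightarrow> 0" by simp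
  with d_le have "?d \<longlonglongrightarrow> 0" by (rule Lim_null_comparison)
  then show thesis unfolding u_def by (rule that[OF r])
qed

lemma hdot_cmat_quadratic:
  "hdot x (cmat M *v y) = (\<Sum>i\<in>UNIV. \<Sum>j\<in>UNIV. cnj (x $ i) * complex_of_real (M $ i $ j) * y $ j)"
  by (simp add: hdot_def cmat_def matrix_vector_mult_def sum_distrib_left ac_simps)

theorem theorem8p1:
  fixes a b :: real and P Q W :: "real \<Rightarrow> real^'n^'n" and K :: "('n + 'n) set"
    and S0 :: "complex^('n+'n)^('n+'n)" and lam0 :: real and y z :: "real \<Rightarrow> complex^'n"
    and U :: "(complex^('n+'n)^('n+'n)) set" and Lam :: "complex^('n+'n)^('n+'n) \<Rightarrow> real"
  assumes "CARD('n) \<ge> 2" and "a < b"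
    and "in_Omega a b P Q W"
    and "hermitian S0"
    and "simple_eigenvalue_SL a b P Q W K S0 lam0"
    and "sl_solution a b P Q W lam0 y z" and "satisfies_bc a b K S0 y z"
    and "integral {a..b} (\<lambda>t. \<Sum>i\<in>UNIV. \<Sum>j\<in>UNIV. cnj (y t $ i) * complex_of_real (W t $ i $ j) * y t $ j) = 1"
    and "\<exists>V. open V \<and> S0 \<in> V \<and> V \<inter> herm_set \<subseteq> U"
    and "simple_branch a b P Q W K S0 lam0 U Lam"
  shows "\<exists>L. (Lam has_derivative L) (at S0 within herm_set) \<and>
     (\<forall>H\<in>herm_set. complex_of_real (L H) =
        (let u = (\<lambda>k. if k \<in> K then bd_eta a b z k else bd_rho a b y k)
         in \<Sum>i\<in>UNIV. \<Sum>j\<in>UNIV. cnj (u i) * H $ i $ j * u j))"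
proof -
  note ab = assms(2) and Om = assms(3) and S0 = assms(4) and simple = assms(5)
    and sol = assms(6) and bc = assms(7) and branch = assms(10)
  obtain V where V: "open V" "S0 \<in> V" "V \<inter> herm_set \<subseteq> U" using assms(9) by blast
  have S0U: "S0 \<in> U" and contU: "continuous_on U Lam" and LamS0: "Lam S0 = lam0"
    and eig: "\<And>S. S \<in> U \<Longrightarrow> is_eigenvalue_SL a b P Q W K S (Lam S)"
    using branch unfolding simple_branch_def by blast+
  have normal: "integral {a..b} (\<lambda>t. hdot (y t) (cmat (W t) *v y t)) = 1"
    using assms(8) unfolding hdot_cmat_quadratic .
  define u where "u = bd_u a b K y z"
  \<comment> \<open>The real part gives a real-linear map on all matrices, as a derivative must be;
    on Hermitian matrices the form is already real.\<close>
  define L where "L = (\<lambda>H. Re (hdot u (H *v u)))"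
  have hdot_H: "complex_of_real (L H) = hdot u (H *v u)" if "hermitian H" for H
  proof -
    have "cnj (hdot u (H *v u)) = hdot (H *v u) u"
      by (simp add: hdot_def mult.commute)
    also have "\<dots> = hdot u (H *v u)" by (rule hdot_hermitian[OF that])
    finally show ?thesis by (simp add: L_def complex_eq_iff)
  qed
  have herm_diff: "hermitian (S - S0)" if "S \<in> herm_set" for S
    unfolding hermitian_def
  proof (intro allI)
    fix i j
    have "S $ i $ j = cnj (S $ j $ i)" "S0 $ i $ j = cnj (S0 $ j $ i)"
      using that S0 unfolding herm_set_def hermitian_def by blast+
    then show "(S - S0) $ i $ j = cnj ((S - S0) $ j $ i)"
      by (simp only: vector_minus_component complex_cnj_diff)
  qed
  have "linear L"
  proof (rule linearI)
    fix A B :: "complex^('n+'n)^('n+'n)" and r :: real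
    show "L (A + B) = L A + L B"
      by (simp add: L_def matrix_vector_mult_add_rdistrib hdot.add_right)
    have "(r *\<^sub>R A) *v u = r *\<^sub>R (A *v u)"
      by (simp add: vec_eq_iff matrix_vector_mult_def scaleR_sum_right)
    then show "L (r *\<^sub>R A) = r *\<^sub>R L A"
      by (simp add: L_def hdot.scaleR_right)
  qed
  then have bl: "bounded_linear L" by (simp add: linear_conv_bounded_linear)
  have "(Lam has_derivative L) (at S0 within herm_set)"
    unfolding has_derivative_within
  proof (intro conjI bl)
    let ?f = "\<lambda>S. (1 / norm (S - S0)) *\<^sub>R (Lam S - (Lam S0 + L (S - S0)))"
    show "(?f \<longlongrightarrow> 0) (at S0 within herm_set)"
      unfolding tendsto_at_iff_sequentially
    proof (intro allI impI)
      fix X :: "nat \<Rightarrow> complex^('n+'n)^('n+'n)"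
      assume X: "\<forall>i. X i \<in> herm_set - {S0}" "X \<longlonglongrightarrow> S0"
      show "(?f \<circ> X) \<longlonglongrightarrow> 0"
      \<comment> \<open>If convergence failed, some subsequence would keep distance at least
        \<open>e\<close> from 0, yet a further subsequence of it tends to 0. This is why
        subsequences suffice.\<close>
      proof (rule tendstoI, rule ccontr)
        fix e :: real assume e: "0 < e"
          and far: "\<not> (\<forall>\<^sub>F n in sequentially. dist ((?f \<circ> X) n) 0 < e)"
        have inV: "\<forall>\<^sub>F n in sequentially. X n \<in> V"
          by (rule topological_tendstoD[OF X(2) V(1,2)])
        \<comment> \<open>Membership in \<open>V\<close> is built into the negated statement so that
          the whole extracted subsequence lies in \<open>U\<close>, where \<open>Lam\<close> is
          continuous and gives eigenvalues.\<close>
        have "\<not> (\<forall>\<^sub>F n in sequentially. X n \<in> V \<longrightarrow> dist ((?f \<circ> X) n) 0 < e)"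
          using far eventually_mp[OF _ inV] by (rule contrapos_nn)
        from not_eventually_sequentiallyD[OF this]
        obtain s :: "nat \<Rightarrow> nat" where s: "strict_mono s"
          and s': "\<forall>n. \<not> (X (s n) \<in> V \<longrightarrow> dist ((?f \<circ> X) (s n)) 0 < e)" by blast
        have sV: "X (s n) \<in> V" and sf: "\<not> dist (?f (X (s n))) 0 < e" for n
          using s'[rule_format, of n] unfolding comp_apply by blast+
        have XU: "X (s n) \<in> U" for n using sV X(1) V(3) by blast
        have Xs: "(\<lambda>n. X (s n)) \<longlonglongrightarrow> S0"
          using LIMSEQ_subseq_LIMSEQ[OF X(2) s] by (simp add: o_def)
        have "(\<lambda>n. Lam (X (s n))) \<longlonglongrightarrow> Lam S0"
          by (rule continuous_on_tendsto_compose[OF contU Xs S0U]) (simp add: XU)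
        then have lam: "(\<lambda>n. Lam (X (s n))) \<longlonglongrightarrow> lam0" by (simp add: LamS0)
        obtain r where r: "strict_mono r"
          "(\<lambda>n. (complex_of_real (Lam (X (s (r n))) - lam0) - hdot u ((X (s (r n)) - S0) *v u))
            /\<^sub>R norm (X (s (r n)) - S0)) \<longlonglongrightarrow> 0"
          by (rule eigenvalue_quotient_subsequence[OF ab Om S0 simple sol bc normal Xs lam eig[OF XU],
                folded u_def]) (rule that)
        have "complex_of_real (?f S) = (complex_of_real (Lam S - lam0) - hdot u ((S - S0) *v u)) /\<^sub>R norm (S - S0)"
          if "S \<in> herm_set" for S
          unfolding hdot_H[OF herm_diff[OF that], symmetric]
          by (simp add: LamS0 scaleR_conv_of_real divide_inverse algebra_simps)
        moreover have "X (s (r n)) \<in> herm_set" for n using X(1) by blast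
        ultimately have "(\<lambda>n. complex_of_real (?f (X (s (r n))))) \<longlonglongrightarrow> complex_of_real 0"
          using r(2) by (simp only: of_real_0)
        then have "(\<lambda>n. ?f (X (s (r n)))) \<longlonglongrightarrow> 0"
          by (simp only: tendsto_of_real_iff)
        then have "\<forall>\<^sub>F n in sequentially. dist (?f (X (s (r n)))) 0 < e"
          using e by (rule tendstoD)
        then show False using sf by (simp only: eventually_sequentially) blast
      qed
    qed
  qed
  moreover have "complex_of_real (L H) = (let u = (\<lambda>k. if k \<in> K then bd_eta a b z k else bd_rho a b y k)
         in \<Sum>i\<in>UNIV. \<Sum>j\<in>UNIV. cnj (u i) * H $ i $ j * u j)" if "H \<in> herm_set" for H
  proof -
    have "complex_of_real (L H) = hdot u (H *v u)" using that hdot_H by (simp add: herm_set_def)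
    then show ?thesis
      by (simp add: Let_def u_def bd_u_def hdot_def matrix_vector_mult_def sum_distrib_left mult.assoc)
  qed
  ultimately show ?thesis by blast
qed

end
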